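(* There exist universal constants $\rho_1\simeq 0.121507$ and $\beta_1\simeq 0.0987043$ such that the following holds. Let $g:D(0,1)\to\mathbb{C}$ be an injective analytic function with $g(0)=0$ and $g'(0)=1$, and let $f=g^{-1}$ be its inverse (defined on $g(D(0,1))$). Then $g(D(0,\beta_1))\subset D(0,\rho_1)$, and $D(0,\rho_1)$ is contained in the immediate basin of attraction of $0$ for the Newton map $N_f$.
   Context: $D(z,r)=\{z'\in\mathbb{C}:|z'-z|<r\}$. The Newton map of $f$ is $N_f(z)=z-f(z)/f'(z)$, defined on $\Omega=g(D(0,1))$. The basin of attraction of $0$ is the set of $z\in\Omega$ all of whose iterates $N_f^n(z)$ are defined (remain in $\Omega$) and converge to $0$; the immediate basin is the connected component of the basin that contains $0$. "Universal" means independent of $g$; $\simeq$ gives the decimal value of the constant to the displayed accuracy. *)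

theory Defs
  imports "HOL-Analysis.Analysis"
begin

definition newton_map :: "(complex \<Rightarrow> complex) \<Rightarrow> complex \<Rightarrow> complex"
  where "newton_map f z = z - f z / deriv f z"

(* A map N defined on \<Omega> is represented by a total function; only its values on \<Omega> matter,
   because every iterate of a point of the basin is required to lie in \<Omega>.
   For N = newton_map f with f holomorphic and injective on the open set \<Omega>, deriv f has no
   zero in \<Omega>, so the HOL convention x / 0 = 0 plays no role there. *)
definition basin_of_attraction ::
    "complex set \<Rightarrow> (complex \<Rightarrow> complex) \<Rightarrow> complex \<Rightarrow> complex set"
  where "basin_of_attraction \<Omega> N p =
    {z \<in> \<Omega>. (\<forall>n. (N ^^ n) z \<in> \<Omega>) \<and> (\<lambda>n. (N ^^ n) z) \<longlonglongrightarrow> p}"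

definition immediate_basin ::
    "complex set \<Rightarrow> (complex \<Rightarrow> complex) \<Rightarrow> complex \<Rightarrow> complex set"
  where "immediate_basin \<Omega> N p = connected_component_set (basin_of_attraction \<Omega> N p) p"

end

theory Submission
  imports Defs "HOL-Complex_Analysis.Complex_Analysis"
begin

text \<open>
  With \<open>z = g w\<close> the Newton map is \<open>N z = g w - w * g' w\<close>, and the derivative of the right-hand
  side in \<open>w\<close> is \<open>- w * g'' w\<close>. Koebe's distortion theorem and the bound for \<open>g''\<close> behind it
  give \<open>\<bar>N z\<bar> \<le> 2 * r\<^sup>2 / (1 - r) ^ 3\<close> for \<open>r = \<bar>w\<bar>\<close>, while \<open>r / (1 + r)\<^sup>2 \<le> \<bar>z\<bar>\<close>; so \<open>N\<close> contracts
  moduli on the disc of radius \<open>\<rho>\<^sub>1\<close>, and the relation \<open>\<beta>\<^sub>1 / (1 - \<beta>\<^sub>1)\<^sup>2 \<simeq> \<rho>\<^sub>1\<close> is the upper growth bound.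

  Everything rests on \<open>\<bar>g'' 0\<bar> \<le> 4\<close>, which follows from the case \<open>\<bar>\<phi>' 0\<bar> \<le> 1\<close> of the area theorem for
  an injective function \<open>1/z + \<phi> z\<close> with \<open>\<phi> 0 = 0\<close>. To avoid Green's formula, we compare the area of the
  image of the annulus \<open>\<epsilon> \<le> \<bar>z\<bar> \<le> r\<close> with that of an ellipse containing it: the image of
  \<open>\<bar>z\<bar> = \<epsilon>\<close> is an ellipse up to an error \<open>O(\<epsilon>\<^sup>2)\<close>, and then \<open>\<epsilon>\<close> tends to 0.
\<close>

subsection \<open>Areas in logarithmic polar coordinates\<close>

lemma cbox_real_2: "cbox a b = {v::real^2. v$1 \<in> {a$1..b$1} \<and> v$2 \<in> {a$2..b$2}}"
  by (auto simp: mem_box_cart forall_2)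

lemma content_cbox_real_2:
  "measure lborel (cbox a b :: (real^2) set) = measure lborel (cbox (a$1,a$2) (b$1,b$2))"
proof (cases "cbox a b = {}")
  case True
  then obtain i where "b$i < a$i"
    by (auto simp: interval_eq_empty_cart)
  then have "cbox (a$1,a$2) (b$1,b$2) = {}"
    using exhaust_2[of i] by (auto simp: cbox_Pair_eq)
  then show ?thesis using True by simp
next
  case False
  then have "a$1 \<le> b$1" "a$2 \<le> b$2"
    by (auto simp: cbox_real_2)
  then show ?thesis
    using False by (simp add: content_cbox_cart content_Pair UNIV_2)
qed

text \<open>The determinant form of the area formula lives on \<open>real^2\<close>, Fubini on
  \<open>real \<times> real\<close>. The coordinate identification sends boxes to boxes of equal
  content, so integrals transfer with factor 1.\<close>

lemma integral_cbox_real_2: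
  fixes f :: "real^2 \<Rightarrow> 'a::banach"
  assumes "continuous_on (cbox a b) f"
  shows "integral (cbox a b) f =
         integral {a$1..b$1} (\<lambda>x. integral {a$2..b$2} (\<lambda>y. f (vector [x, y])))"
proof -
  define to_vec :: "real \<times> real \<Rightarrow> real^2" where "to_vec p = vector [fst p, snd p]" for p
  define of_vec :: "real^2 \<Rightarrow> real \<times> real" where "of_vec v = (v$1, v$2)" for v
  have of_to: "of_vec (to_vec p) = p" for p by (simp add: of_vec_def to_vec_def)
  have to_of: "to_vec (of_vec v) = v" for v by (simp add: of_vec_def to_vec_def vec_eq_iff forall_2)
  have lin: "linear to_vec"
    by (auto simp: linear_iff to_vec_def vec_eq_iff forall_2)
  have im_to: "to_vec ` cbox (u1,u2) (v1,v2) = cbox (vector [u1,u2]) (vector [v1,v2])" for u1 u2 v1 v2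
  proof (intro set_eqI iffI)
    fix w :: "real^2" assume "w \<in> cbox (vector [u1,u2]) (vector [v1,v2])"
    then have "of_vec w \<in> cbox (u1,u2) (v1,v2)"
      by (simp add: of_vec_def cbox_real_2 cbox_Pair_eq)
    then show "w \<in> to_vec ` cbox (u1,u2) (v1,v2)"
      by (metis image_eqI to_of)
  qed (auto simp: to_vec_def cbox_real_2 cbox_Pair_eq)
  have im_of: "of_vec ` cbox u v = cbox (u$1,u$2) (v$1,v$2)" for u v
  proof -
    have "cbox u v = to_vec ` cbox (u$1,u$2) (v$1,v$2)"
      using im_to[of "u$1" "u$2" "v$1" "v$2"] to_of[of u] to_of[of v] by (simp add: to_vec_def of_vec_def)
    then show ?thesis by (simp add: image_image of_to)
  qed
  have "((\<lambda>p. f (to_vec p)) has_integral (1 / 1) *\<^sub>R integral (cbox a b) f) (of_vec ` cbox a b)"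
  proof (rule has_integral_twiddle)
    show "measure lborel (to_vec ` cbox u v) = 1 * measure lborel (cbox u v)" for u v
      by (cases u; cases v) (simp add: im_to content_cbox_real_2)
    show "\<exists>w z. to_vec ` cbox u v = cbox w z" for u v
      by (cases u; cases v; simp only: im_to) blast
    show "\<exists>w z. of_vec ` cbox u v = cbox w z" for u v
      by (simp only: im_of) blast
    show "continuous (at x) to_vec" for x
      using lin by (simp add: linear_continuous_at linear_conv_bounded_linear)
    show "(f has_integral integral (cbox a b) f) (cbox a b)"
      using integrable_continuous[OF assms] by (rule integrable_integral)
  qed (simp_all add: of_to to_of)
  then have "integral (cbox a b) f = integral (cbox (a$1,a$2) (b$1,b$2)) (\<lambda>p. f (to_vec p))"
    by (simp add: im_of integral_unique)
  moreover have "continuous_on (cbox (a$1,a$2) (b$1,b$2)) (\<lambda>p. f (to_vec p))"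
  proof (rule continuous_on_compose2[OF assms])
    show "continuous_on (cbox (a$1,a$2) (b$1,b$2)) to_vec"
      using lin by (simp add: linear_continuous_on linear_conv_bounded_linear)
  qed (auto simp: to_vec_def cbox_real_2 cbox_Pair_eq)
  ultimately show ?thesis
    by (simp add: integral_prod_continuous to_vec_def)
qed

text \<open>Cauchy's formula at the centre: on the circle, \<open>du / u\<close> is
  \<open>\<i> dt\<close>. It supplies the angular averages in the area estimate.\<close>

lemma has_integral_circle_mean:
  assumes "f holomorphic_on ball 0 R" "0 < s" "s < R"
  shows "((\<lambda>t. f (of_real s * cis t)) has_integral 2 * of_real pi * f 0) {0..2*pi}"
proof -
  have "((\<lambda>u. f u / (u - 0)) has_contour_integral 2 * of_real pi * \<i> * f 0) (circlepath 0 s)"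
    by (rule Cauchy_integral_circlepath_simple) (use assms in \<open>auto intro: holomorphic_on_subset\<close>)
  then have "((\<lambda>t. f (of_real s * cis t) * \<i>) has_integral 2 * of_real pi * \<i> * f 0) {0..2*pi}"
    using \<open>0 < s\<close> unfolding circlepath_def
    by (subst (asm) has_contour_integral_part_circlepath_iff) (simp_all add: field_simps)
  note has_integral_mult_left[OF this, of "-\<i>"]
  moreover have "2 * of_real pi * \<i> * x * (-\<i>) = 2 * of_real pi * x" "x * \<i> * (-\<i>) = x" for x
    using i_squared by algebra+
  ultimately show ?thesis
    by (simp only:)
qed

text \<open>The map \<open>w \<mapsto> w - c * cnj w\<close> has real Jacobian
  \<open>1 - |c|^2\<close>, and multiplication by \<open>d\<close> has Jacobian
  \<open>|d|^2\<close>.\<close>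

lemma det_matrix_twisted_multiplication:
  fixes c d :: complex and D :: "real^2 \<Rightarrow> real^2"
  assumes "\<And>h. D h = (let w = d * Complex (h$1) (h$2); u = w - c * cnj w in vector [Re u, Im u])"
  shows "det (matrix D) = (1 - (cmod c)\<^sup>2) * (cmod d)\<^sup>2"
proof -
  have D: "D h $ 1 = (Re d * h$1 - Im d * h$2) - Re c * (Re d * h$1 - Im d * h$2) - Im c * (Re d * h$2 + Im d * h$1)"
    "D h $ 2 = (Re d * h$2 + Im d * h$1) - Im c * (Re d * h$1 - Im d * h$2) + Re c * (Re d * h$2 + Im d * h$1)" for h
    unfolding assms Let_def by (simp_all add: algebra_simps)
  have "det (matrix D) = D (axis 1 1) $ 1 * D (axis 2 1) $ 2 - D (axis 2 1) $ 1 * D (axis 1 1) $ 2"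
    by (simp add: det_2 matrix_def)
  also have "\<dots> = (1 - (cmod c)\<^sup>2) * (cmod d)\<^sup>2"
    unfolding cmod_power2 D by (simp add: axis_def) algebra
  finally show ?thesis .
qed

text \<open>The map \<open>w \<mapsto> w - c * cnj w\<close> is allowed to act on the image because it rounds off an ellipse
  close to a disc.\<close>

lemma area_twisted_image_le:
  fixes a b :: "real^2" and K :: "complex \<Rightarrow> complex"
  defines "\<iota> \<equiv> \<lambda>v::real^2. Complex (v$1) (v$2)"
  assumes K: "K holomorphic_on U" "open U" "\<iota> ` cbox a b \<subseteq> U"
    and inj: "inj_on K (\<iota> ` box a b)"
    and c: "cmod c < 1"
    and R: "0 \<le> R" "\<And>v. v \<in> box a b \<Longrightarrow> cmod (K (\<iota> v) - c * cnj (K (\<iota> v))) \<le> R"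
  shows "(1 - (cmod c)\<^sup>2) * integral (cbox a b) (\<lambda>v. (cmod (deriv K (\<iota> v)))\<^sup>2) \<le> pi * R\<^sup>2"
proof -
  define T where "T w = (let u = w - c * cnj w in vector [Re u, Im u] :: real^2)" for w
  have T: "linear T"
    by (auto simp: linear_iff T_def Let_def vec_eq_iff forall_2 algebra_simps)
  have \<iota>: "linear \<iota>"
    by (auto simp: linear_iff \<iota>_def complex_eq_iff)
  have norm_T: "norm (T w) = cmod (w - c * cnj w)" for w
    by (simp add: T_def Let_def norm_vec_def L2_set_def sum_2 cmod_def)
  \<comment> \<open>A nonzero fixed point of \<open>x \<mapsto> c * cnj x\<close> would force
    \<open>|c| = 1\<close>.\<close>
  have ker_T: "x = 0" if "T x = 0" for x
  proof -
    have "c * cnj x = x"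
      by (metis norm_T norm_zero norm_eq_zero right_minus_eq that)
    then have "cmod c * cmod x = cmod x"
      by (metis norm_mult complex_mod_cnj)
    then show ?thesis
      using c by auto
  qed
  have inj_T: "w = z" if "T w = T z" for w z
    using ker_T[of "w - z"] that T by (simp add: linear_diff)
  define F where "F v = T (K (\<iota> v))" for v
  define F' where "F' v h = T (deriv K (\<iota> v) * \<iota> h)" for v h
  have der: "(F has_derivative F' v) (at v within box a b)" if "v \<in> box a b" for v
  proof -
    have "\<iota> v \<in> U"
      using K(3) that box_subset_cbox by blast
    then have "(K has_derivative (*) (deriv K (\<iota> v))) (at (\<iota> v))"
      using K holomorphic_derivI has_field_derivative_def by blast
    moreover have "(\<iota> has_derivative \<iota>) (at v within box a b)"
      using \<iota> by (simp add: bounded_linear_imp_has_derivative linear_conv_bounded_linear)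
    ultimately have "((\<lambda>v. K (\<iota> v)) has_derivative (\<lambda>h. deriv K (\<iota> v) * \<iota> h)) (at v within box a b)"
      by (rule has_derivative_compose[rotated])
    from bounded_linear.has_derivative[OF T[unfolded linear_conv_bounded_linear] this] show ?thesis
      by (simp only: F_def[abs_def] F'_def[abs_def])
  qed
  have det: "\<bar>det (matrix (F' v))\<bar> = (1 - (cmod c)\<^sup>2) * (cmod (deriv K (\<iota> v)))\<^sup>2" for v
  proof -
    have "det (matrix (F' v)) = (1 - (cmod c)\<^sup>2) * (cmod (deriv K (\<iota> v)))\<^sup>2"
      by (rule det_matrix_twisted_multiplication) (simp only: F'_def T_def \<iota>_def Let_def)
    moreover have "(cmod c)\<^sup>2 \<le> 1"
      using c by (simp add: power_le_one)
    ultimately show ?thesis by simp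
  qed
  have inj_F: "inj_on F (box a b)"
  proof (rule inj_onI)
    fix v w assume vw: "v \<in> box a b" "w \<in> box a b" "F v = F w"
    then have "K (\<iota> v) = K (\<iota> w)"
      using inj_T by (simp only: F_def)
    then have "\<iota> v = \<iota> w"
      using inj vw(1,2) by (meson inj_onD imageI)
    then show "v = w"
      by (simp add: \<iota>_def vec_eq_iff forall_2)
  qed
  have "continuous_on U (deriv K)"
    using K by (simp add: holomorphic_deriv holomorphic_on_imp_continuous_on)
  moreover have "continuous_on (cbox a b) \<iota>"
    using \<iota> by (simp add: linear_continuous_on linear_conv_bounded_linear)
  ultimately have "continuous_on (cbox a b) (\<lambda>v. deriv K (\<iota> v))"
    using K(3) by (rule continuous_on_compose2)
  then have "(\<lambda>v. \<bar>det (matrix (F' v))\<bar>) integrable_on cbox a b"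
    unfolding det by (intro integrable_continuous continuous_intros)
  \<comment> \<open>The open box matters: in polar coordinates the edges of angle 0 and 2 pi have
    the same image, so injectivity is available only inside. Dropping the boundary does not change
    the integral.\<close>
  then have int: "(\<lambda>v. \<bar>det (matrix (F' v))\<bar>) integrable_on box a b"
    by (simp add: integrable_on_open_interval)
  have "F ` box a b \<subseteq> cball 0 R"
    using R by (auto simp: F_def norm_T)
  moreover have "F ` box a b \<in> lmeasurable"
    using measurable_differentiable_image_eq[OF _ der inj_F] int by simp
  ultimately have "measure lebesgue (F ` box a b) \<le> measure lebesgue (cball (0::real^2) R)"
    by (intro measure_mono_fmeasurable) auto
  also have "\<dots> = pi * R\<^sup>2"
    using R by (simp add: content_cball unit_ball_vol_2)
  finally have "integral (box a b) (\<lambda>v. \<bar>det (matrix (F' v))\<bar>) \<le> pi * R\<^sup>2"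
    using measure_differentiable_image_eq[OF _ der inj_F int] by simp
  then show ?thesis
    unfolding det by (simp add: integral_open_interval)
qed

text \<open>The removable-singularity quotient \<open>q\<close>, applied twice, divides the
  remainder by \<open>z^2\<close> and leaves a holomorphic function, which is bounded on the compact
  disc of radius \<open>r\<close>.\<close>

lemma second_order_remainder_bound:
  assumes "\<phi> holomorphic_on ball 0 R" "r < R"
  obtains C where "0 \<le> C" "\<And>z. cmod z \<le> r \<Longrightarrow> cmod (\<phi> z - \<phi> 0 - deriv \<phi> 0 * z) \<le> C * (cmod z)\<^sup>2"
proof -
  define q where "q f = (\<lambda>z. if z = 0 then deriv f 0 else (f z - f 0) / (z - 0))" for f :: "complex \<Rightarrow> complex"
  have q: "q f holomorphic_on ball 0 R" if "f holomorphic_on ball 0 R" for f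
    unfolding q_def by (rule pole_lemma_open[OF that]) auto
  have "continuous_on (cball 0 r) (q (q \<phi>))"
    using q[OF q[OF assms(1)]] assms(2)
    by (intro holomorphic_on_imp_continuous_on) (auto intro: holomorphic_on_subset)
  then have "bounded (q (q \<phi>) ` cball 0 r)"
    by (intro compact_imp_bounded compact_continuous_image) auto
  then obtain C where C: "0 < C" "\<And>z. cmod z \<le> r \<Longrightarrow> cmod (q (q \<phi>) z) \<le> C"
    by (auto simp: bounded_pos)
  have "\<phi> z - \<phi> 0 - deriv \<phi> 0 * z = q (q \<phi>) z * z\<^sup>2" for z
    by (cases "z = 0") (auto simp: q_def field_simps power2_eq_square)
  then show thesis
    using that[of C] C by (simp add: norm_mult norm_power mult_right_mono)
qed

text \<open>Here \<open>w\<close> stands for \<open>\<phi> z\<close> and \<open>b\<close> for its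
  linear coefficient. On \<open>|z| = \<epsilon>\<close> one has
  \<open>cnj (1/z) = z / \<epsilon>^2\<close>, so the twist by \<open>b * \<epsilon>^2\<close>
  cancels the term \<open>b * z\<close>, and the image is a circle of radius
  \<open>1/\<epsilon>\<close> up to order \<open>\<epsilon>^2\<close>. For larger \<open>|z|\<close>
  the drop of \<open>1/|z|\<close> outweighs what the other terms gain, provided
  \<open>\<epsilon>\<close> is small.\<close>

lemma twisted_laurent_bound:
  fixes b z w :: complex
  assumes \<epsilon>: "0 < \<epsilon>" "\<epsilon> \<le> cmod z" and z: "cmod z \<le> 1"
    and "0 \<le> C" and w: "cmod (w - b * z) \<le> C * (cmod z)\<^sup>2"
    and D: "D = C + cmod b * (cmod b + C)" and small: "2 * \<epsilon> * (cmod b + D) \<le> 1"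
  shows "cmod ((1/z + w) - b * \<epsilon>\<^sup>2 * cnj (1/z + w)) \<le> 1/\<epsilon> + D * \<epsilon>\<^sup>2"
proof -
  define s where "s = cmod z"
  define B where "B = cmod b"
  have s: "0 < s" "\<epsilon> \<le> s" "s \<le> 1" and B: "0 \<le> B"
    using assms by (auto simp: s_def B_def)
  have z0: "z \<noteq> 0" using s by (auto simp: s_def)
  have cnj: "cnj (1/z) = z / s\<^sup>2"
    using z0 complex_norm_square[of z] by (simp add: s_def field_simps)
  have "(1/z + w) - b * \<epsilon>\<^sup>2 * cnj (1/z + w) =
      1/z + b * z * of_real (1 - \<epsilon>\<^sup>2 / s\<^sup>2) + ((w - b * z) - b * \<epsilon>\<^sup>2 * cnj w)"
    unfolding complex_cnj_add cnj by (simp add: field_simps)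
  also have "cmod \<dots> \<le> cmod (1/z) + cmod (b * z * of_real (1 - \<epsilon>\<^sup>2 / s\<^sup>2)) +
      (cmod (w - b * z) + cmod (b * \<epsilon>\<^sup>2 * cnj w))"
    by (intro order_trans[OF norm_triangle_ineq] add_mono order_refl norm_triangle_ineq4)
  also have "\<dots> \<le> 1/s + B * (s - \<epsilon>\<^sup>2 / s) + (C * s\<^sup>2 + B * s\<^sup>2 * (B + C))"
  proof (intro add_mono)
    show "cmod (1/z) \<le> 1/s" by (simp add: norm_divide s_def)
    have "\<epsilon>\<^sup>2 \<le> s\<^sup>2" using s \<epsilon> by (simp add: power_mono)
    then have "0 \<le> 1 - \<epsilon>\<^sup>2 / s\<^sup>2" using s by simp
    then have "cmod (b * z * of_real (1 - \<epsilon>\<^sup>2 / s\<^sup>2)) = B * s * (1 - \<epsilon>\<^sup>2 / s\<^sup>2)"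
      by (simp only: norm_mult norm_of_real abs_of_nonneg B_def s_def)
    also have "\<dots> = B * (s - \<epsilon>\<^sup>2 / s)"
      using s by (simp add: field_simps power2_eq_square)
    finally show "cmod (b * z * of_real (1 - \<epsilon>\<^sup>2 / s\<^sup>2)) \<le> B * (s - \<epsilon>\<^sup>2 / s)" by simp
    show "cmod (w - b * z) \<le> C * s\<^sup>2" using w by (simp add: s_def)
    have "cmod w \<le> cmod (w - b * z) + cmod (b * z)"
      by (metis diff_add_cancel norm_triangle_ineq)
    also have "\<dots> \<le> C * s\<^sup>2 + B * s" using w by (simp add: s_def B_def norm_mult)
    also have "\<dots> \<le> C * 1 + B * 1"
      using s B \<open>0 \<le> C\<close> by (intro add_mono mult_left_mono) (auto simp: power_le_one)
    finally have "cmod w \<le> B + C" by simp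
    then have "cmod (b * \<epsilon>\<^sup>2 * cnj w) \<le> B * \<epsilon>\<^sup>2 * (B + C)"
      by (simp add: norm_mult norm_power B_def mult_left_mono)
    also have "\<dots> \<le> B * s\<^sup>2 * (B + C)"
      using \<open>\<epsilon>\<^sup>2 \<le> s\<^sup>2\<close> B \<open>0 \<le> C\<close> by (intro mult_right_mono mult_left_mono) auto
    finally show "cmod (b * \<epsilon>\<^sup>2 * cnj w) \<le> B * s\<^sup>2 * (B + C)" .
  qed
  also have "\<dots> = 1/s + B * (s - \<epsilon>\<^sup>2 / s) + D * s\<^sup>2"
    by (simp add: D B_def algebra_simps)
  also have "\<dots> \<le> 1/\<epsilon> + D * \<epsilon>\<^sup>2"
  proof -
    have "0 \<le> D" using D \<open>0 \<le> C\<close> by simp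
    have "\<epsilon> * (B * (s + \<epsilon>) + D * s * (s + \<epsilon>)) \<le> \<epsilon> * (B * 2 + D * 1 * 2)"
      using s \<epsilon> B \<open>0 \<le> D\<close> by (intro mult_left_mono add_mono mult_mono) auto
    also have "\<dots> \<le> 1" using small by (simp add: B_def algebra_simps)
    \<comment> \<open>The difference of the two bounds contains the factor
      \<open>s - \<epsilon>\<close>; the smallness hypothesis makes the cofactor
      nonnegative.\<close>
    finally have "0 \<le> (s - \<epsilon>) / (\<epsilon> * s) * (1 - \<epsilon> * (B * (s + \<epsilon>) + D * s * (s + \<epsilon>)))"
      using s \<epsilon> by simp
    also have "\<dots> = 1/\<epsilon> + D * \<epsilon>\<^sup>2 - (1/s + B * (s - \<epsilon>\<^sup>2 / s) + D * s\<^sup>2)"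
      using s \<epsilon> by (simp add: field_simps power2_eq_square)
    finally show ?thesis by simp
  qed
  finally show ?thesis .
qed

lemma power2_cmod_diff: "(cmod (x - y))\<^sup>2 = (cmod x)\<^sup>2 + (cmod y)\<^sup>2 - 2 * Re (x * cnj y)"
  unfolding cmod_power2 by (simp add: power2_eq_square algebra_simps)

text \<open>In the coordinate \<open>log z\<close> the annulus becomes a rectangle, and
  \<open>|deriv K|^2\<close> is the area density of the image. Its integral is bounded below by
  \<open>pi\<close> times the second factor on the left, which is the area obtained when
  \<open>\<phi>\<close> is replaced by its linear part. The disc of radius \<open>R\<close> contains
  the twisted image.\<close>

lemma area_annulus_bound:
  fixes \<phi> :: "complex \<Rightarrow> complex"
  assumes \<phi>: "\<phi> holomorphic_on ball 0 1"
    and inj: "inj_on (\<lambda>z. 1/z + \<phi> z) (ball 0 1 - {0})"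
    and r: "0 < \<epsilon>" "\<epsilon> < r" "r < 1"
    and c: "cmod c < 1"
    and bound: "\<And>z. \<epsilon> \<le> cmod z \<Longrightarrow> cmod z \<le> r \<Longrightarrow>
                  cmod ((1/z + \<phi> z) - c * cnj (1/z + \<phi> z)) \<le> R"
  defines "B \<equiv> cmod (deriv \<phi> 0)"
  shows "(1 - (cmod c)\<^sup>2) * (1/\<epsilon>\<^sup>2 - 1/r\<^sup>2 + B\<^sup>2 * (r\<^sup>2 - \<epsilon>\<^sup>2)) \<le> R\<^sup>2"
proof -
  define b where "b = deriv \<phi> 0"
  define K where "K u = 1 / exp u + \<phi> (exp u)" for u
  define l u :: "real^2" where "l = vector [ln \<epsilon>, 0]" and "u = vector [ln r, 2 * pi]"
  define \<iota> where "\<iota> v = Complex (v$1) (v$2)" for v :: "real^2"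
  have exp_\<iota>: "exp (\<iota> v) = of_real (exp (v$1)) * cis (v$2)" for v
    by (simp add: \<iota>_def exp_eq_polar)
  have Re_\<iota>: "Re (\<iota> v) = v$1" for v
    by (simp add: \<iota>_def)
  have in_annulus: "\<epsilon> \<le> exp (v$1) \<and> exp (v$1) \<le> r" if "v \<in> cbox l u" for v :: "real^2"
  proof -
    have "exp (ln \<epsilon>) \<le> exp (v$1) \<and> exp (v$1) \<le> exp (ln r)"
      unfolding exp_le_cancel_iff using that by (simp add: cbox_real_2 l_def u_def)
    then show ?thesis using r by simp
  qed
  have neg: "v$1 < 0" if "v \<in> cbox l u" for v :: "real^2"
    using in_annulus[OF that] r by (simp flip: exp_less_one_iff)
  have \<phi>': "deriv \<phi> holomorphic_on ball 0 1"
    using \<phi> by (simp add: holomorphic_deriv)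
  have DK: "(K has_field_derivative (- 1 / exp w + deriv \<phi> (exp w) * exp w)) (at w)"
    if "Re w < 0" for w
  proof -
    have "(\<phi> has_field_derivative deriv \<phi> (exp w)) (at (exp w))"
      using \<phi> that by (intro holomorphic_derivI) auto
    then have "((\<lambda>w. \<phi> (exp w)) has_field_derivative deriv \<phi> (exp w) * exp w) (at w)"
      by (rule DERIV_chain2) (rule DERIV_exp)
    then show ?thesis
      unfolding K_def[abs_def]
      by (auto intro!: derivative_eq_intros simp: field_simps)
  qed
  have "(1 - (cmod c)\<^sup>2) * integral (cbox l u) (\<lambda>v. (cmod (deriv K (\<iota> v)))\<^sup>2) \<le> pi * R\<^sup>2"
    unfolding \<iota>_def
  proof (rule area_twisted_image_le)
    show "K holomorphic_on {w. Re w < 0}"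
      using DK by (auto simp: holomorphic_on_open open_halfspace_Re_lt)
    show "open {w. Re w < 0}" by (rule open_halfspace_Re_lt)
    show "(\<lambda>v. Complex (v$1) (v$2)) ` cbox l u \<subseteq> {w. Re w < 0}"
      using neg by auto
    show "inj_on K ((\<lambda>v. Complex (v$1) (v$2)) ` box l u)"
    proof (rule inj_onI)
      fix p q
      assume "p \<in> (\<lambda>v. Complex (v$1) (v$2)) ` box l u" "q \<in> (\<lambda>v. Complex (v$1) (v$2)) ` box l u"
        and eq: "K p = K q"
      then obtain v w where vw: "v \<in> box l u" "w \<in> box l u" "p = \<iota> v" "q = \<iota> w"
        by (auto simp: \<iota>_def)
      have "exp (\<iota> v) \<in> ball 0 1 - {0}" "exp (\<iota> w) \<in> ball 0 1 - {0}"
        using vw neg[of v] neg[of w] box_subset_cbox[of l u] by (auto simp: Re_\<iota>)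
      then have "exp (\<iota> v) = exp (\<iota> w)"
        using inj eq vw by (auto simp: inj_on_def K_def)
      moreover have "\<bar>Im (\<iota> v) - Im (\<iota> w)\<bar> < 2 * pi"
        using vw(1,2) by (auto simp: mem_box_cart forall_2 \<iota>_def l_def u_def)
      ultimately show "p = q"
        unfolding vw by (rule exp_complex_eqI[rotated])
    qed
    show "cmod (K (Complex (v$1) (v$2)) - c * cnj (K (Complex (v$1) (v$2)))) \<le> R"
      if "v \<in> box l u" for v :: "real^2"
      using bound[of "exp (\<iota> v)"] in_annulus[of v] that box_subset_cbox[of l u]
      by (auto simp: Re_\<iota> K_def \<iota>_def)
    have "0 \<le> cmod ((1/of_real r + \<phi> (of_real r)) - c * cnj (1/of_real r + \<phi> (of_real r)))"
      by (rule norm_ge_zero)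
    also have "\<dots> \<le> R" by (rule bound) (use r in auto)
    finally show "0 \<le> R" .
  qed (rule c)
  moreover
  \<comment> \<open>For \<open>|z| = s\<close> the density is
    \<open>1/s^2 - (2/s^2) * Re (z^2 * \<phi>') + s^2 * |\<phi>'|^2\<close>. Replacing
    \<open>|\<phi>'|^2\<close> by \<open>2 * Re (cnj b * \<phi>') - B^2\<close>, a lower bound
    because \<open>|\<phi>' - b|^2 \<ge> 0\<close>, leaves the real part of a function holomorphic
    in \<open>z\<close> for fixed \<open>s\<close>. Its mean over the circle is therefore its value
    at 0, and no power series is involved.\<close>
  define G where "G s z = 1/of_real s^2 - 2 / of_real s^2 * (z\<^sup>2 * deriv \<phi> z) +
      of_real s^2 * (2 * cnj b * deriv \<phi> z - of_real (B\<^sup>2))" for s z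
  have mean_G: "((\<lambda>y. Re (G s (of_real s * cis y))) has_integral 2 * pi * (1/s\<^sup>2 + B\<^sup>2 * s\<^sup>2)) {0..2*pi}"
    if "0 < s" "s < 1" for s
  proof -
    have "G s holomorphic_on ball 0 1"
      unfolding G_def[abs_def] using that by (intro holomorphic_intros \<phi>') auto
    from has_integral_circle_mean[OF this that]
    have "((\<lambda>y. G s (of_real s * cis y)) has_integral 2 * of_real pi * G s 0) {0..2*pi}" .
    from has_integral_linear[OF this bounded_linear_Re]
    have "((\<lambda>y. Re (G s (of_real s * cis y))) has_integral Re (2 * of_real pi * G s 0)) {0..2*pi}"
      by (simp add: o_def)
    moreover have "G s 0 = of_real (1/s\<^sup>2 + B\<^sup>2 * s\<^sup>2)"
      using complex_norm_square[of b] by (simp add: G_def B_def b_def algebra_simps)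
    ultimately show ?thesis by simp
  qed
  have G_le: "Re (G (cmod z) z) \<le> (cmod (- 1 / z + deriv \<phi> z * z))\<^sup>2" if "z \<noteq> 0" for z
  proof -
    define s where "s = cmod z"
    have "s > 0" using that by (simp add: s_def)
    have "cnj (1 / z) = z / of_real (s\<^sup>2)"
      using that complex_norm_square[of z] by (simp add: s_def field_simps)
    then have "deriv \<phi> z * z * cnj (1 / z) = z\<^sup>2 * deriv \<phi> z / of_real (s\<^sup>2)"
      by (simp add: power2_eq_square)
    then have "Re (deriv \<phi> z * z * cnj (1 / z)) = Re (z\<^sup>2 * deriv \<phi> z) / s\<^sup>2"
      by (simp only: Re_divide_of_real)
    moreover have "(cmod (- 1 / z + deriv \<phi> z * z))\<^sup>2 = (cmod (deriv \<phi> z * z - 1 / z))\<^sup>2"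
      by simp
    moreover have "\<dots> = (cmod (deriv \<phi> z * z))\<^sup>2 + (cmod (1 / z))\<^sup>2 - 2 * Re (deriv \<phi> z * z * cnj (1 / z))"
      by (rule power2_cmod_diff)
    moreover have "(cmod (deriv \<phi> z * z))\<^sup>2 = s\<^sup>2 * (cmod (deriv \<phi> z))\<^sup>2" "(cmod (1 / z))\<^sup>2 = 1 / s\<^sup>2"
      by (simp_all add: norm_mult norm_divide power_mult_distrib power_divide s_def)
    ultimately have "(cmod (- 1 / z + deriv \<phi> z * z))\<^sup>2 =
        s\<^sup>2 * (cmod (deriv \<phi> z))\<^sup>2 + 1 / s\<^sup>2 - 2 / s\<^sup>2 * Re (z\<^sup>2 * deriv \<phi> z)"
      by (simp only: times_divide_eq_left times_divide_eq_right)
    moreover have "2 * Re (cnj b * deriv \<phi> z) - B\<^sup>2 \<le> (cmod (deriv \<phi> z))\<^sup>2"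
    proof -
      have "0 \<le> (cmod (deriv \<phi> z - b))\<^sup>2" by simp
      then show ?thesis
        unfolding power2_cmod_diff by (simp add: B_def b_def mult.commute)
    qed
    then have "s\<^sup>2 * (2 * Re (cnj b * deriv \<phi> z) - B\<^sup>2) \<le> s\<^sup>2 * (cmod (deriv \<phi> z))\<^sup>2"
      by (rule mult_left_mono) simp
    moreover have "Re (G s z) = 1 / s\<^sup>2 - 2 / s\<^sup>2 * Re (z\<^sup>2 * deriv \<phi> z) +
        s\<^sup>2 * (2 * Re (cnj b * deriv \<phi> z) - B\<^sup>2)"
    proof -
      have "G s z = (1 / s\<^sup>2) *\<^sub>R 1 - (2 / s\<^sup>2) *\<^sub>R (z\<^sup>2 * deriv \<phi> z) +
          s\<^sup>2 *\<^sub>R (2 *\<^sub>R (cnj b * deriv \<phi> z) - B\<^sup>2 *\<^sub>R 1)"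
        by (simp add: G_def scaleR_conv_of_real mult.assoc)
      then show ?thesis
        by (simp only: plus_complex.sel minus_complex.sel scaleR_complex.sel one_complex.sel mult_1_right)
    qed
    ultimately show ?thesis
      unfolding s_def[symmetric] by linarith
  qed
  define W where "W v = Re (G (exp (v$1)) (exp (\<iota> v)))" for v :: "real^2"
  have cont: "continuous_on (cbox l u) \<iota>"
    unfolding \<iota>_def[abs_def] Complex_eq by (intro continuous_intros)
  have cont': "continuous_on (cbox l u) (\<lambda>v. deriv \<phi> (exp (\<iota> v)))"
  proof (rule continuous_on_compose2[where g = "deriv \<phi>"])
    show "continuous_on (ball 0 1) (deriv \<phi>)"
      using \<phi>' by (rule holomorphic_on_imp_continuous_on)
    show "(\<lambda>v. exp (\<iota> v)) ` cbox l u \<subseteq> ball 0 1"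
      using neg by (auto simp: Re_\<iota>)
  qed (intro continuous_intros cont)
  have cont_W: "continuous_on (cbox l u) W"
    unfolding W_def[abs_def] G_def[abs_def] by (intro continuous_intros cont cont') auto
  have deriv_K: "deriv K (\<iota> v) = - 1 / exp (\<iota> v) + deriv \<phi> (exp (\<iota> v)) * exp (\<iota> v)"
    if "v \<in> cbox l u" for v
    using neg[OF that] by (intro DERIV_imp_deriv DK) (simp add: Re_\<iota>)
  have "continuous_on (cbox l u) (\<lambda>v. (cmod (deriv K (\<iota> v)))\<^sup>2)"
  proof (rule continuous_on_eq)
    show "continuous_on (cbox l u)
        (\<lambda>v. (cmod (- 1 / exp (\<iota> v) + deriv \<phi> (exp (\<iota> v)) * exp (\<iota> v)))\<^sup>2)"
      by (intro continuous_intros cont cont') auto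
  qed (simp add: deriv_K)
  then have "integral (cbox l u) W \<le> integral (cbox l u) (\<lambda>v. (cmod (deriv K (\<iota> v)))\<^sup>2)"
    using cont_W
  proof (intro integral_le integrable_continuous)
    fix v :: "real^2" assume "v \<in> cbox l u"
    then show "W v \<le> (cmod (deriv K (\<iota> v)))\<^sup>2"
      using G_le[of "exp (\<iota> v)"] by (simp add: deriv_K W_def Re_\<iota>)
  qed
  moreover have "integral (cbox l u) W = pi * (1/\<epsilon>\<^sup>2 - 1/r\<^sup>2 + B\<^sup>2 * (r\<^sup>2 - \<epsilon>\<^sup>2))"
  proof -
    have "integral (cbox l u) W =
        integral {ln \<epsilon>..ln r} (\<lambda>x. integral {0..2*pi} (\<lambda>y. W (vector [x, y])))"
      using integral_cbox_real_2[OF cont_W] by (simp add: l_def u_def)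
    also have "\<dots> = integral {ln \<epsilon>..ln r} (\<lambda>x. 2 * pi * (1/(exp x)\<^sup>2 + B\<^sup>2 * (exp x)\<^sup>2))"
    proof (rule Henstock_Kurzweil_Integration.integral_cong)
      fix x assume "x \<in> {ln \<epsilon>..ln r}"
      then have "exp x \<le> r" using r by (simp add: ln_ge_iff)
      then have "exp x < 1" using r by linarith
      from mean_G[OF exp_gt_zero this]
      show "integral {0..2*pi} (\<lambda>y. W (vector [x, y])) = 2 * pi * (1/(exp x)\<^sup>2 + B\<^sup>2 * (exp x)\<^sup>2)"
        unfolding W_def exp_\<iota> by (intro integral_unique) simp
    qed
    also have "\<dots> = pi * (B\<^sup>2 * (exp (ln r))\<^sup>2 - 1/(exp (ln r))\<^sup>2) - pi * (B\<^sup>2 * (exp (ln \<epsilon>))\<^sup>2 - 1/(exp (ln \<epsilon>))\<^sup>2)"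
    proof (rule integral_unique, rule fundamental_theorem_of_calculus)
      show "ln \<epsilon> \<le> ln r" using r by simp
      show "((\<lambda>x. pi * (B\<^sup>2 * (exp x)\<^sup>2 - 1/(exp x)\<^sup>2)) has_vector_derivative
          2 * pi * (1/(exp x)\<^sup>2 + B\<^sup>2 * (exp x)\<^sup>2)) (at x within {ln \<epsilon>..ln r})" for x
        unfolding has_real_derivative_iff_has_vector_derivative[symmetric]
        by (auto intro!: derivative_eq_intros simp: field_simps power2_eq_square)
    qed
    also have "\<dots> = pi * (1/\<epsilon>\<^sup>2 - 1/r\<^sup>2 + B\<^sup>2 * (r\<^sup>2 - \<epsilon>\<^sup>2))"
      using r by (simp add: algebra_simps)
    finally show ?thesis .
  qed
  ultimately have "(1 - (cmod c)\<^sup>2) * (pi * (1/\<epsilon>\<^sup>2 - 1/r\<^sup>2 + B\<^sup>2 * (r\<^sup>2 - \<epsilon>\<^sup>2))) \<le> pi * R\<^sup>2"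
    using c by (smt (verit) mult_left_mono norm_ge_zero power_le_one)
  then have "pi * ((1 - (cmod c)\<^sup>2) * (1/\<epsilon>\<^sup>2 - 1/r\<^sup>2 + B\<^sup>2 * (r\<^sup>2 - \<epsilon>\<^sup>2))) \<le> pi * R\<^sup>2"
    by (simp add: mult_ac)
  then show ?thesis
    by simp
qed

subsection \<open>The area theorem and the second coefficient\<close>

text \<open>With \<open>c = b * \<epsilon>^2\<close> and
  \<open>R = 1/\<epsilon> + D * \<epsilon>^2\<close>, both sides of the annulus estimate grow like
  \<open>1/\<epsilon>^2\<close>. These terms cancel, and \<open>\<epsilon>\<close> tending to 0
  leaves \<open>B^2 * r^2 \<le> 1/r^2\<close> for every \<open>r < 1\<close>.\<close>

theorem area_theorem_first_coefficient:
  fixes \<phi> :: "complex \<Rightarrow> complex"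
  assumes \<phi>: "\<phi> holomorphic_on ball 0 1" "\<phi> 0 = 0"
    and inj: "inj_on (\<lambda>z. 1/z + \<phi> z) (ball 0 1 - {0})"
  shows "cmod (deriv \<phi> 0) \<le> 1"
proof -
  define b where "b = deriv \<phi> 0"
  define B where "B = cmod b"
  have B: "0 \<le> B" by (simp add: B_def)
  have key: "B * r\<^sup>2 \<le> 1" if r: "0 < r" "r < 1" for r
  proof -
    obtain C where C: "0 \<le> C"
      "\<And>z. cmod z \<le> r \<Longrightarrow> cmod (\<phi> z - \<phi> 0 - deriv \<phi> 0 * z) \<le> C * (cmod z)\<^sup>2"
      using second_order_remainder_bound[OF \<phi>(1) r(2)] by blast
    define D where "D = C + B * (B + C)"
    have D: "0 \<le> D" using B C by (simp add: D_def)
    \<comment> \<open>The last bound on \<open>\<epsilon>\<close> gives the smallness condition of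
      \<open>twisted_laurent_bound\<close> and, with \<open>\<epsilon> < r < 1\<close>, also
      \<open>B * \<epsilon>^2 < 1\<close>; the summand 1 keeps the denominator positive.\<close>
    have ineq: "(1 - (B * \<epsilon>\<^sup>2)\<^sup>2) * (1/\<epsilon>\<^sup>2 - 1/r\<^sup>2 + B\<^sup>2 * (r\<^sup>2 - \<epsilon>\<^sup>2)) \<le> (1/\<epsilon> + D * \<epsilon>\<^sup>2)\<^sup>2"
      if \<epsilon>: "0 < \<epsilon>" "\<epsilon> < r" "\<epsilon> < 1 / (2 * (B + D + 1))" for \<epsilon>
    proof -
      have small: "2 * \<epsilon> * (B + D + 1) < 1"
        using \<epsilon>(3) B D by (simp add: field_simps)
      then have small': "2 * \<epsilon> * (B + D) \<le> 1"
        using \<epsilon>(1) by (simp add: algebra_simps)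
      have "\<epsilon> * B \<le> 2 * \<epsilon> * (B + D)" using \<epsilon>(1) B D by (simp add: algebra_simps)
      then have "\<epsilon> * B \<le> 1" using small' by linarith
      then have "\<epsilon> * (\<epsilon> * B) < 1"
        using \<epsilon> r mult_left_mono[of "\<epsilon> * B" 1 \<epsilon>] by linarith
      then have Be: "B * \<epsilon>\<^sup>2 < 1" by (simp add: power2_eq_square mult_ac)
      have norm_c: "cmod (b * of_real (\<epsilon>\<^sup>2)) = B * \<epsilon>\<^sup>2"
        by (simp add: norm_mult norm_power B_def)
      have "(1 - (cmod (b * of_real (\<epsilon>\<^sup>2)))\<^sup>2) *
          (1/\<epsilon>\<^sup>2 - 1/r\<^sup>2 + (cmod (deriv \<phi> 0))\<^sup>2 * (r\<^sup>2 - \<epsilon>\<^sup>2)) \<le> (1/\<epsilon> + D * \<epsilon>\<^sup>2)\<^sup>2"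
      proof (rule area_annulus_bound[OF \<phi>(1) inj \<epsilon>(1,2) r(2)])
        show "cmod (b * of_real (\<epsilon>\<^sup>2)) < 1" using Be norm_c by simp
        fix z assume z: "\<epsilon> \<le> cmod z" "cmod z \<le> r"
        show "cmod ((1/z + \<phi> z) - b * of_real (\<epsilon>\<^sup>2) * cnj (1/z + \<phi> z)) \<le> 1/\<epsilon> + D * \<epsilon>\<^sup>2"
        proof (rule twisted_laurent_bound)
          show "cmod (\<phi> z - b * z) \<le> C * (cmod z)\<^sup>2"
            using C(2)[OF z(2)] \<phi>(2) by (simp add: b_def)
          show "cmod z \<le> 1" using z(2) r(2) by simp
          show "D = C + cmod b * (cmod b + C)" by (simp add: D_def B_def)
          show "2 * \<epsilon> * (cmod b + D) \<le> 1" using small' by (simp add: B_def)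
        qed (use \<epsilon> z C in auto)
      qed
      then show ?thesis
        unfolding norm_c by (simp only: B_def b_def)
    qed
    \<comment> \<open>\<open>L\<close> is the left side of \<open>ineq\<close> minus the right side
      with the poles in \<open>\<epsilon>\<close> cancelled: a polynomial, hence continuous at 0,
      where it equals \<open>B^2 * r^2 - 1/r^2\<close>.\<close>
    define L where "L \<epsilon> = (1 - (B * \<epsilon>\<^sup>2)\<^sup>2) * (B\<^sup>2 * (r\<^sup>2 - \<epsilon>\<^sup>2) - 1/r\<^sup>2) - B\<^sup>2 * \<epsilon>\<^sup>2 - 2 * D * \<epsilon> - D\<^sup>2 * \<epsilon> ^ 4" for \<epsilon>
    have "L \<epsilon> \<le> 0" if \<epsilon>: "0 < \<epsilon>" "\<epsilon> < r" "\<epsilon> < 1 / (2 * (B + D + 1))" for \<epsilon>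
    proof -
      have "(1 - (B * \<epsilon>\<^sup>2)\<^sup>2) * (1/\<epsilon>\<^sup>2 - 1/r\<^sup>2 + B\<^sup>2 * (r\<^sup>2 - \<epsilon>\<^sup>2)) - (1/\<epsilon> + D * \<epsilon>\<^sup>2)\<^sup>2 =
          (1 - (B * \<epsilon>\<^sup>2)\<^sup>2) * (B\<^sup>2 * (r\<^sup>2 - \<epsilon>\<^sup>2) - 1/r\<^sup>2) + (1 - (B * \<epsilon>\<^sup>2)\<^sup>2) * (1/\<epsilon>\<^sup>2) - (1/\<epsilon> + D * \<epsilon>\<^sup>2)\<^sup>2"
        by (simp add: algebra_simps)
      moreover have "(1 - (B * \<epsilon>\<^sup>2)\<^sup>2) * (1/\<epsilon>\<^sup>2) - (1/\<epsilon> + D * \<epsilon>\<^sup>2)\<^sup>2 = - B\<^sup>2 * \<epsilon>\<^sup>2 - 2 * D * \<epsilon> - D\<^sup>2 * \<epsilon> ^ 4"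
        using \<epsilon>(1) by (simp add: field_simps power2_eq_square power4_eq_xxxx)
      ultimately show ?thesis
        using ineq[OF \<epsilon>] by (simp add: L_def)
    qed
    then have "\<forall>\<^sub>F \<epsilon> in at_right 0. L \<epsilon> \<le> 0"
      unfolding eventually_at_right_field
      using B D r by (intro exI[of _ "min r (1 / (2 * (B + D + 1)))"]) auto
    moreover have "(L \<longlongrightarrow> L 0) (at_right 0)"
      unfolding L_def by (intro tendsto_intros)
    ultimately have "L 0 \<le> 0"
      by (intro tendsto_upperbound) auto
    then have "B\<^sup>2 * r\<^sup>2 \<le> 1 / r\<^sup>2" by (simp add: L_def)
    then have "(B * r\<^sup>2)\<^sup>2 \<le> 1\<^sup>2"
      using r by (simp add: field_simps power2_eq_square)
    then show ?thesis
      by (rule power2_le_imp_le) simp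
  qed
  \<comment> \<open>Here \<open>z\<close> is \<open>r^2\<close>, and letting it approach 1 gives the
    theorem.\<close>
  have "z * B \<le> 1" if "0 < z" "z < 1" for z
    using key[of "sqrt z"] that by (simp add: mult.commute)
  then have "B \<le> 1" by (rule field_le_mult_one_interval)
  then show ?thesis by (simp add: B_def b_def)
qed

definition schlicht :: "(complex \<Rightarrow> complex) \<Rightarrow> bool"
  where "schlicht g \<longleftrightarrow> g holomorphic_on ball 0 1 \<and> inj_on g (ball 0 1) \<and> g 0 = 0 \<and> deriv g 0 = 1"

lemma schlicht_eq_0_iff: "schlicht g \<Longrightarrow> z \<in> ball 0 1 \<Longrightarrow> g z = 0 \<longleftrightarrow> z = 0"
  unfolding schlicht_def by (metis inj_on_contraD centre_in_ball zero_less_one)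

text \<open>The area theorem is applied to the reciprocal of the odd square root \<open>z * H (z\<^sup>2)\<close> of \<open>g (z\<^sup>2)\<close>.\<close>

theorem bieberbach_second_coefficient:
  assumes g: "schlicht g"
  shows "cmod (deriv (deriv g) 0) \<le> 4"
proof -
  have holg: "g holomorphic_on ball 0 1" and inj: "inj_on g (ball 0 1)" and g0: "g 0 = 0" and g1: "deriv g 0 = 1"
    using g by (auto simp: schlicht_def)
  define q where "q f = (\<lambda>z. if z = 0 then deriv f 0 else (f z - f 0) / (z - 0))" for f :: "complex \<Rightarrow> complex"
  have q: "q f holomorphic_on ball 0 1" if "f holomorphic_on ball 0 1" for f
    unfolding q_def by (rule pole_lemma_open[OF that]) auto
  have q_mult: "f z = f 0 + z * q f z" for f z
    by (auto simp: q_def)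
  have q0: "q f 0 = deriv f 0" for f by (simp add: q_def)
  have nz: "q g z \<noteq> 0" if "z \<in> ball 0 1" for z
    using schlicht_eq_0_iff[OF g that] g0 g1 by (simp add: q_def)
  obtain H where H: "H holomorphic_on ball 0 1" "\<And>z. z \<in> ball 0 1 \<Longrightarrow> q g z = (H z)\<^sup>2"
    using contractible_imp_holomorphic_sqrt[OF q[OF holg] _ nz]
    by (auto simp: convex_imp_contractible)
  have H_nz: "H z \<noteq> 0" if "z \<in> ball 0 1" for z
    using nz[OF that] H(2)[OF that] by auto
  define m where "m z = 1 / H z" for z
  have holm: "m holomorphic_on ball 0 1"
    unfolding m_def[abs_def] using H H_nz by (intro holomorphic_intros) auto
  have m_q: "(m z)\<^sup>2 * q g z = 1" if "z \<in> ball 0 1" for z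
    using H(2)[OF that] H_nz[OF that] by (simp add: m_def power_divide)
  have m0: "(m 0)\<^sup>2 = 1"
    using m_q[of 0] by (simp add: q0 g1)
  \<comment> \<open>The reciprocal of the odd square root is \<open>m (z^2) / z\<close>. Its residue
    \<open>m 0\<close> is only known to be a square root of 1, so multiplying by \<open>m 0\<close>
    normalises the pole to \<open>1/z\<close>; \<open>\<phi>\<close> is the remaining part.\<close>
  define \<phi> where "\<phi> z = z * (m 0 * q m (z\<^sup>2))" for z
  have sq: "z\<^sup>2 \<in> ball 0 1" if "z \<in> ball 0 1" for z :: complex
    using that by (simp add: norm_power power_less_one_iff)
  have holq: "(\<lambda>z. m 0 * q m (z\<^sup>2)) holomorphic_on ball 0 1"
  proof (intro holomorphic_intros)
    have "q m \<circ> (\<lambda>z. z\<^sup>2) holomorphic_on ball 0 1"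
      by (rule holomorphic_on_compose_gen[OF _ q[OF holm]]) (use sq in \<open>auto intro!: holomorphic_intros\<close>)
    then show "(\<lambda>z. q m (z\<^sup>2)) holomorphic_on ball 0 1" by (simp add: o_def)
  qed
  have recip: "1/z + \<phi> z = m 0 * m (z\<^sup>2) / z" if "z \<noteq> 0" for z
    using that q_mult[of m "z\<^sup>2"] m0 by (simp add: \<phi>_def field_simps power2_eq_square)
  have "cmod (deriv \<phi> 0) \<le> 1"
  proof (rule area_theorem_first_coefficient)
    show "\<phi> holomorphic_on ball 0 1"
      unfolding \<phi>_def[abs_def] by (intro holomorphic_intros holq)
    show "\<phi> 0 = 0" by (simp add: \<phi>_def)
    show "inj_on (\<lambda>z. 1/z + \<phi> z) (ball 0 1 - {0})"
    proof (rule inj_onI)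
      fix z w :: complex
      assume zw: "z \<in> ball 0 1 - {0}" "w \<in> ball 0 1 - {0}" and eq: "1/z + \<phi> z = 1/w + \<phi> w"
      have sq_in: "z\<^sup>2 \<in> ball 0 1" "w\<^sup>2 \<in> ball 0 1"
        using zw sq by auto
      have "m 0 \<noteq> 0" using m0 by auto
      with eq zw have "m (z\<^sup>2) / z = m (w\<^sup>2) / w"
        by (simp add: recip flip: times_divide_eq_right)
      \<comment> \<open>The squares of the two sides are \<open>g (z^2)\<close> and
        \<open>g (w^2)\<close>, which gives only \<open>z^2 = w^2\<close>. The sign is recovered
        from \<open>hz\<close> itself, whose nonzero factors \<open>H\<close> have then become
        equal.\<close>
      then have hz: "z * H (z\<^sup>2) = w * H (w\<^sup>2)"
        using zw H_nz[OF sq_in(1)] H_nz[OF sq_in(2)] by (simp add: m_def field_simps)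
      have "g (u\<^sup>2) = (u * H (u\<^sup>2))\<^sup>2" if "u\<^sup>2 \<in> ball 0 1" for u
        using q_mult[of g "u\<^sup>2"] H(2)[OF that] g0 by (simp add: power_mult_distrib)
      then have "g (z\<^sup>2) = g (w\<^sup>2)"
        using hz sq_in by simp
      then have "z\<^sup>2 = w\<^sup>2"
        using inj sq_in by (auto dest: inj_onD)
      then have "z * H (w\<^sup>2) = w * H (w\<^sup>2)" using hz by simp
      then show "z = w" using H_nz[OF sq_in(2)] by simp
    qed
  qed
  moreover have "deriv \<phi> 0 = m 0 * deriv m 0"
  proof (rule DERIV_imp_deriv)
    have "((\<lambda>z. m 0 * q m (z\<^sup>2)) has_field_derivative deriv (\<lambda>z. m 0 * q m (z\<^sup>2)) 0) (at 0)"
      by (rule holomorphic_derivI[OF holq]) auto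
    from DERIV_mult[OF DERIV_ident this] show "(\<phi> has_field_derivative m 0 * deriv m 0) (at 0)"
      by (simp add: \<phi>_def[abs_def] q0)
  qed
  \<comment> \<open>Differentiate \<open>m^2 * q g = 1\<close> at 0, where
    \<open>(m 0)^2 = q g 0 = 1\<close>.\<close>
  moreover have "2 * (m 0 * deriv m 0) + deriv (q g) 0 = 0"
  proof -
    have "(m has_field_derivative deriv m 0) (at 0)" "(q g has_field_derivative deriv (q g) 0) (at 0)"
      using holomorphic_derivI[OF holm] holomorphic_derivI[OF q[OF holg]] by auto
    then have "((\<lambda>z. (m z)\<^sup>2 * q g z) has_field_derivative
        2 * (m 0 * deriv m 0) * q g 0 + (m 0)\<^sup>2 * deriv (q g) 0) (at 0)"
      by (auto intro!: derivative_eq_intros)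
    moreover have "((\<lambda>z. (m z)\<^sup>2 * q g z) has_field_derivative 0) (at 0)"
      by (rule has_field_derivative_transform_within_open[of "\<lambda>_. 1" _ _ "ball 0 1"]) (auto simp: m_q)
    ultimately show ?thesis
      using DERIV_unique by (fastforce simp: m0 q0 g1)
  qed
  \<comment> \<open>Since \<open>g z = z * q g z\<close>, two derivatives at 0 give
    \<open>deriv (q g) 0\<close> twice. With the preceding relation this yields the factor
    -4.\<close>
  moreover have "deriv (deriv g) 0 = 2 * deriv (q g) 0"
  proof (rule DERIV_imp_deriv)
    have dq: "(q g has_field_derivative deriv (q g) z) (at z)" if "z \<in> ball 0 1" for z
      using holomorphic_derivI[OF q[OF holg] _ that] by auto
    have dg: "deriv g z = q g z + z * deriv (q g) z" if "z \<in> ball 0 1" for z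
    proof (rule DERIV_imp_deriv)
      have "((\<lambda>z. z * q g z) has_field_derivative q g z + z * deriv (q g) z) (at z)"
        using dq[OF that] by (auto intro!: derivative_eq_intros)
      moreover have "(\<lambda>z. z * q g z) = g"
      proof (rule ext)
        fix u show "u * q g u = g u"
          by (subst (2) q_mult) (simp add: g0)
      qed
      ultimately show "(g has_field_derivative q g z + z * deriv (q g) z) (at z)"
        by (simp only:)
    qed
    have "(deriv (q g) has_field_derivative deriv (deriv (q g)) 0) (at 0)"
      by (rule holomorphic_derivI[of _ "ball 0 1"]) (auto intro: holomorphic_deriv q holg)
    then have "((\<lambda>z. q g z + z * deriv (q g) z) has_field_derivative 2 * deriv (q g) 0) (at 0)"
      using dq[of 0] by (auto intro!: derivative_eq_intros)
    then show "(deriv g has_field_derivative 2 * deriv (q g) 0) (at 0)"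
      by (rule has_field_derivative_transform_within_open[of _ _ _ "ball 0 1"]) (auto simp: dg)
  qed
  ultimately have "deriv (deriv g) 0 = - 4 * deriv \<phi> 0"
    by (simp add: add_eq_0_iff2 algebra_simps)
  then show ?thesis
    using \<open>cmod (deriv \<phi> 0) \<le> 1\<close> by (simp add: norm_mult)
qed

subsection \<open>Distortion and growth of schlicht functions\<close>

lemma schlicht_deriv_nonzero: "schlicht g \<Longrightarrow> z \<in> ball 0 1 \<Longrightarrow> deriv g z \<noteq> 0"
  using holomorphic_injective_imp_regular[of g "ball 0 1"] by (simp add: schlicht_def)

lemma schlicht_DERIV:
  assumes "schlicht g" "z \<in> ball 0 1"
  shows "(g has_field_derivative deriv g z) (at z)"
    and "(deriv g has_field_derivative deriv (deriv g) z) (at z)"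
  using assms unfolding schlicht_def
  by (auto intro!: holomorphic_derivI[of _ "ball 0 1"] holomorphic_deriv)

text \<open>Koebe transform: precompose \<open>g\<close> with the disc automorphism taking 0 to
  \<open>a\<close> and renormalise. The result \<open>F\<close> is schlicht, and Bieberbach's bound
  on \<open>F''\<close> at 0, multiplied by \<open>|g' a|\<close>, is the claim.\<close>

lemma koebe_transform_bound:
  assumes g: "schlicht g" and a: "cmod a < 1"
  shows "cmod (of_real (1 - (cmod a)\<^sup>2) * deriv (deriv g) a - 2 * cnj a * deriv g a) \<le> 4 * cmod (deriv g a)"
proof -
  define M where "M = Moebius_function 0 (- a)"
  define \<delta> where "\<delta> = 1 - (cmod a)\<^sup>2"
  have "(cmod a)\<^sup>2 < 1" using a by (simp add: abs_square_less_1)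
  then have "\<delta> \<noteq> 0" by (simp add: \<delta>_def)
  have \<delta>: "of_real \<delta> = 1 - cnj a * a"
    using complex_norm_square[of a] by (simp add: \<delta>_def mult.commute)
  have nz: "1 + cnj a * \<zeta> \<noteq> 0" if "cmod \<zeta> < 1" for \<zeta>
  proof
    assume "1 + cnj a * \<zeta> = 0"
    then have "cmod a * cmod \<zeta> = 1"
      by (metis add_eq_0_iff complex_mod_cnj norm_minus_cancel norm_mult norm_one)
    moreover have "cmod a * cmod \<zeta> < 1"
      using a that by (metis mult_strict_mono' mult_1 norm_ge_zero)
    ultimately show False by simp
  qed
  have M: "M \<zeta> = (\<zeta> + a) / (1 + cnj a * \<zeta>)" for \<zeta>
    by (simp add: M_def Moebius_function_simple)
  have M_ball: "M \<zeta> \<in> ball 0 1" if "cmod \<zeta> < 1" for \<zeta>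
    using Moebius_function_norm_lt_1[of "-a" \<zeta> 0] a that by (simp add: M_def)
  have DM: "(M has_field_derivative of_real \<delta> / (1 + cnj a * \<zeta>)\<^sup>2) (at \<zeta>)" if "cmod \<zeta> < 1" for \<zeta>
    unfolding M[abs_def] \<delta> using nz[OF that]
    by (auto intro!: derivative_eq_intros simp: field_simps power2_eq_square)
  have g'a: "deriv g a \<noteq> 0" using schlicht_deriv_nonzero[OF g] a by simp
  define F where "F \<zeta> = (g (M \<zeta>) - g a) / (of_real \<delta> * deriv g a)" for \<zeta>
  have DF: "(F has_field_derivative deriv g (M \<zeta>) / (deriv g a * (1 + cnj a * \<zeta>)\<^sup>2)) (at \<zeta>)"
    if "cmod \<zeta> < 1" for \<zeta>
  proof -
    have "((\<lambda>\<zeta>. g (M \<zeta>)) has_field_derivative deriv g (M \<zeta>) * (of_real \<delta> / (1 + cnj a * \<zeta>)\<^sup>2)) (at \<zeta>)"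
      by (rule DERIV_chain2[OF schlicht_DERIV(1)[OF g M_ball[OF that]] DM[OF that]])
    then show ?thesis
      unfolding F_def[abs_def] using \<open>\<delta> \<noteq> 0\<close> g'a nz[OF that]
      by (auto intro!: derivative_eq_intros simp: field_simps)
  qed
  have M0: "M 0 = a" by (simp add: M)
  have "schlicht F"
    unfolding schlicht_def
  proof (intro conjI)
    show "F holomorphic_on ball 0 1"
      unfolding holomorphic_on_open[OF open_ball] using DF by (meson mem_ball_0)
    show "F 0 = 0" by (simp add: F_def M0)
    show "deriv F 0 = 1"
      using DF[of 0] g'a by (simp add: M0 DERIV_imp_deriv)
    show "inj_on F (ball 0 1)"
    proof (rule inj_onI)
      fix x y assume xy: "x \<in> ball 0 1" "y \<in> ball 0 1" "F x = F y"
      then have "g (M x) = g (M y)"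
        using \<open>\<delta> \<noteq> 0\<close> g'a by (simp add: F_def)
      then have "M x = M y"
        using g M_ball xy by (auto simp: schlicht_def dest: inj_onD)
      then show "x = y"
        using Moebius_function_compose[of a "-a"] a xy unfolding M_def
        by (metis add.inverse_inverse mem_ball_0 norm_minus_cancel)
    qed
  qed
  moreover have "deriv (deriv F) 0 = (of_real \<delta> * deriv (deriv g) a - 2 * cnj a * deriv g a) / deriv g a"
  proof (rule DERIV_imp_deriv)
    have "((\<lambda>\<zeta>. deriv g (M \<zeta>)) has_field_derivative deriv (deriv g) (M 0) * (of_real \<delta> / (1 + cnj a * 0)\<^sup>2)) (at 0)"
      by (rule DERIV_chain2[OF schlicht_DERIV(2)[OF g M_ball] DM]) auto
    then have "((\<lambda>\<zeta>. deriv g (M \<zeta>) / (deriv g a * (1 + cnj a * \<zeta>)\<^sup>2)) has_field_derivative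
        (of_real \<delta> * deriv (deriv g) a - 2 * cnj a * deriv g a) / deriv g a) (at 0)"
      using g'a by (auto intro!: derivative_eq_intros simp: M0 field_simps power2_eq_square)
    then show "(deriv F has_field_derivative
        (of_real \<delta> * deriv (deriv g) a - 2 * cnj a * deriv g a) / deriv g a) (at 0)"
      by (rule has_field_derivative_transform_within_open[of _ _ _ "ball 0 1"])
         (auto simp: DERIV_imp_deriv[OF DF])
  qed
  ultimately have "cmod ((of_real \<delta> * deriv (deriv g) a - 2 * cnj a * deriv g a) / deriv g a) \<le> 4"
    using bieberbach_second_coefficient by metis
  then show ?thesis
    using g'a by (simp add: norm_divide field_simps \<delta>_def)
qed

text \<open>With \<open>p\<close> a logarithm of \<open>g'\<close>, the Koebe transform bound
  becomes \<open>|(1 - |w|^2) * p' - 2 * cnj w| \<le> 4\<close>. Along a radius this encloses the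
  derivative of \<open>ln |g'|\<close> between two rational functions, whose primitives give the two
  bounds.\<close>

lemma koebe_distortion:
  assumes g: "schlicht g" and z: "cmod z < 1"
  shows "(1 - cmod z) / (1 + cmod z) ^ 3 \<le> cmod (deriv g z)"
    and "cmod (deriv g z) \<le> (1 + cmod z) / (1 - cmod z) ^ 3"
proof -
  have "deriv g holomorphic_on ball 0 1"
    using g by (auto simp: schlicht_def intro: holomorphic_deriv)
  then obtain p where p: "p holomorphic_on ball 0 1" "\<And>z. z \<in> ball 0 1 \<Longrightarrow> deriv g z = exp (p z)"
    using contractible_imp_holomorphic_log[of "deriv g" "ball 0 1"] schlicht_deriv_nonzero[OF g]
    by (metis convex_ball convex_imp_contractible)
  have Dp: "(p has_field_derivative deriv p w) (at w)" if "w \<in> ball 0 1" for w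
    using holomorphic_derivI[OF p(1) _ that] by auto
  have p_bound: "cmod (of_real (1 - (cmod w)\<^sup>2) * deriv p w - 2 * cnj w) \<le> 4" if "w \<in> ball 0 1" for w
  proof -
    have "deriv (deriv g) w = deriv g w * deriv p w"
    proof (rule DERIV_imp_deriv)
      have "((\<lambda>w. exp (p w)) has_field_derivative deriv g w * deriv p w) (at w)"
        unfolding p(2)[OF that] by (rule DERIV_chain2[OF DERIV_exp Dp[OF that]])
      then show "(deriv g has_field_derivative deriv g w * deriv p w) (at w)"
        by (rule has_field_derivative_transform_within_open[of _ _ _ "ball 0 1"])
           (use that p(2) in auto)
    qed
    then have "of_real (1 - (cmod w)\<^sup>2) * deriv (deriv g) w - 2 * cnj w * deriv g w =
        deriv g w * (of_real (1 - (cmod w)\<^sup>2) * deriv p w - 2 * cnj w)"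
      by (simp add: algebra_simps)
    with koebe_transform_bound[OF g, of w] that
    have "cmod (deriv g w) * cmod (of_real (1 - (cmod w)\<^sup>2) * deriv p w - 2 * cnj w) \<le> cmod (deriv g w) * 4"
      by (simp add: norm_mult)
    then show ?thesis
      using schlicht_deriv_nonzero[OF g that] by simp
  qed
  \<comment> \<open>The direction of \<open>z\<close>; the value 1 at \<open>z = 0\<close> keeps
    \<open>cmod e = 1\<close> without a case split.\<close>
  define e where "e = (if z = 0 then 1 else z / of_real (cmod z))"
  have e: "cmod e = 1" "z = of_real (cmod z) * e"
    by (auto simp: e_def norm_divide)
  have te: "of_real t * e \<in> ball 0 1" if "0 \<le> t" "t \<le> cmod z" for t
    using that z e by (simp add: norm_mult)
  define h where "h t = Re (p (of_real t * e))" for t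
  define h' where "h' t = Re (e * deriv p (of_real t * e))" for t
  have Dh: "(h has_real_derivative h' t) (at t)" if "0 \<le> t" "t \<le> cmod z" for t
  proof -
    have "((\<lambda>t. of_real t * e) has_vector_derivative e) (at t)"
      by (auto intro!: derivative_eq_intros simp: scaleR_conv_of_real)
    from field_vector_diff_chain_at[OF this Dp[OF te[OF that]]]
    have "((\<lambda>t. p (of_real t * e)) has_vector_derivative e * deriv p (of_real t * e)) (at t)"
      by (simp add: o_def)
    from bounded_linear.has_vector_derivative[OF bounded_linear_Re this] show ?thesis
      unfolding has_real_derivative_iff_has_vector_derivative h_def[abs_def] h'_def by simp
  qed
  have h': "(2 * t - 4) / (1 - t\<^sup>2) \<le> h' t" "h' t \<le> (2 * t + 4) / (1 - t\<^sup>2)" if "0 \<le> t" "t \<le> cmod z" for t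
  proof -
    have t: "t < 1" using that z by simp
    then have "t\<^sup>2 < 1" using that by (simp add: power_less_one_iff abs_square_less_1)
    \<comment> \<open>Multiplying by \<open>e\<close> turns \<open>cnj (t * e)\<close> into the real
      number \<open>t\<close>, so the real part isolates \<open>h' t\<close>.\<close>
    have "cmod (e * (of_real (1 - t\<^sup>2) * deriv p (of_real t * e) - 2 * cnj (of_real t * e))) \<le> 4"
      using p_bound[OF te[OF that]] e(1) that by (simp add: norm_mult)
    moreover have "e * cnj e = 1"
      using complex_norm_square[of e] e(1) by simp
    then have "e * (of_real (1 - t\<^sup>2) * deriv p (of_real t * e) - 2 * cnj (of_real t * e)) =
        (1 - t\<^sup>2) *\<^sub>R (e * deriv p (of_real t * e)) - of_real (2 * t)"
      by (simp add: scaleR_conv_of_real algebra_simps)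
    ultimately have "\<bar>Re ((1 - t\<^sup>2) *\<^sub>R (e * deriv p (of_real t * e)) - of_real (2 * t))\<bar> \<le> 4"
      using abs_Re_le_cmod order_trans by metis
    then have "\<bar>(1 - t\<^sup>2) * h' t - 2 * t\<bar> \<le> 4"
      by (simp only: minus_complex.sel scaleR_complex.sel Re_complex_of_real h'_def)
    then show "(2 * t - 4) / (1 - t\<^sup>2) \<le> h' t" "h' t \<le> (2 * t + 4) / (1 - t\<^sup>2)"
      using \<open>t\<^sup>2 < 1\<close> by (auto simp: field_simps abs_le_iff)
  qed
  have h0: "h 0 = 0"
  proof -
    have "exp (h 0) = cmod (deriv g 0)" using p(2)[of 0] by (simp add: h_def)
    then show ?thesis using g by (simp add: schlicht_def)
  qed
  have hz: "cmod (deriv g z) = exp (h (cmod z))"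
    using p(2)[of z] z e(2) by (simp add: h_def)
  have ln_sq: "1 - t\<^sup>2 = (1 - t) * (1 + t)" for t :: real
    by (simp add: power2_eq_square algebra_simps)
  have pos: "0 < 1 + cmod z" "1 + cmod z \<noteq> 0"
    by (smt (verit) norm_ge_zero)+
  \<comment> \<open>\<open>ln (1 + t) - 3 * ln (1 - t)\<close> is the primitive of
    \<open>(2 * t + 4) / (1 - t^2)\<close> vanishing at 0; \<open>L\<close> below does the same for
    the lower bound.\<close>
  define U where "U t = ln (1 + t) - 3 * ln (1 - t) - h t" for t
  have "U 0 \<le> U (cmod z)"
  proof (rule DERIV_nonneg_imp_nondecreasing[where f = U])
    fix t assume t: "0 \<le> t" "t \<le> cmod z"
    then have "t < 1" using z by simp
    have "(U has_real_derivative (2 * t + 4) / (1 - t\<^sup>2) - h' t) (at t)"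
      unfolding ln_sq U_def[abs_def] using t \<open>t < 1\<close>
      by (auto intro!: derivative_eq_intros Dh simp: divide_simps)
    then show "\<exists>y. (U has_real_derivative y) (at t) \<and> 0 \<le> y"
      using h'(2)[OF t] by (intro exI[of _ "(2 * t + 4) / (1 - t\<^sup>2) - h' t"]) auto
  qed simp
  then have "h (cmod z) \<le> ln (1 + cmod z) - 3 * ln (1 - cmod z)"
    by (simp add: h0 U_def)
  also have "\<dots> = ln ((1 + cmod z) / (1 - cmod z) ^ 3)"
    using z pos by (simp add: ln_div ln_realpow)
  finally show "cmod (deriv g z) \<le> (1 + cmod z) / (1 - cmod z) ^ 3"
    using z unfolding hz by (subst (asm) ln_ge_iff) (auto intro!: divide_pos_pos add_pos_nonneg)
  define L where "L t = h t - (ln (1 - t) - 3 * ln (1 + t))" for t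
  have "L 0 \<le> L (cmod z)"
  proof (rule DERIV_nonneg_imp_nondecreasing[where f = L])
    fix t assume t: "0 \<le> t" "t \<le> cmod z"
    then have "t < 1" using z by simp
    have "(L has_real_derivative h' t - (2 * t - 4) / (1 - t\<^sup>2)) (at t)"
      unfolding ln_sq L_def[abs_def] using t \<open>t < 1\<close>
      by (auto intro!: derivative_eq_intros Dh simp: divide_simps)
    then show "\<exists>y. (L has_real_derivative y) (at t) \<and> 0 \<le> y"
      using h'(1)[OF t] by (intro exI[of _ "h' t - (2 * t - 4) / (1 - t\<^sup>2)"]) auto
  qed simp
  then have "ln (1 - cmod z) - 3 * ln (1 + cmod z) \<le> h (cmod z)"
    by (simp add: h0 L_def)
  moreover have "ln (1 - cmod z) - 3 * ln (1 + cmod z) = ln ((1 - cmod z) / (1 + cmod z) ^ 3)"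
    using z pos by (simp add: ln_div ln_realpow)
  ultimately have "exp (ln ((1 - cmod z) / (1 + cmod z) ^ 3)) \<le> exp (h (cmod z))"
    by simp
  moreover have "0 < (1 - cmod z) / (1 + cmod z) ^ 3"
    using z by (intro divide_pos_pos zero_less_power add_pos_nonneg) auto
  ultimately show "(1 - cmod z) / (1 + cmod z) ^ 3 \<le> cmod (deriv g z)"
    unfolding hz by (metis exp_ln)
qed

text \<open>The mean value inequality along the radius to \<open>z\<close>. It turns pointwise
  derivative bounds into the growth bound and into the bound on the Newton map.\<close>

lemma norm_le_radial_primitive:
  fixes F :: "complex \<Rightarrow> complex" and \<psi> :: "real \<Rightarrow> real"
  assumes F: "\<And>w. cmod w < 1 \<Longrightarrow> (F has_field_derivative F' w) (at w)" "F 0 = 0"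
    and \<psi>: "\<And>t. 0 \<le> t \<Longrightarrow> t < 1 \<Longrightarrow> (\<psi> has_real_derivative \<psi>' t) (at t)" "\<psi> 0 = 0"
    and le: "\<And>w. cmod w < 1 \<Longrightarrow> cmod (F' w) \<le> \<psi>' (cmod w)"
    and z: "cmod z < 1"
  shows "cmod (F z) \<le> \<psi> (cmod z)"
proof (cases "z = 0")
  case True
  then show ?thesis using F \<psi> by simp
next
  case False
  define e where "e = z / of_real (cmod z)"
  have e: "cmod e = 1" "z = of_real (cmod z) * e"
    using False by (auto simp: e_def norm_divide)
  have te: "cmod (of_real t * e) = t" if "0 \<le> t" for t
    using that e by (simp add: norm_mult)
  have D: "((\<lambda>t. F (of_real t * e)) has_vector_derivative e * F' (of_real t * e)) (at t)"
    if "0 \<le> t" "t \<le> cmod z" for t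
  proof -
    have "((\<lambda>t. of_real t * e) has_vector_derivative e) (at t)"
      by (auto intro!: derivative_eq_intros simp: scaleR_conv_of_real)
    moreover have "cmod (of_real t * e) < 1"
      using te[OF that(1)] that z by simp
    ultimately show ?thesis
      using field_vector_diff_chain_at[of "\<lambda>t. of_real t * e" e t F] F(1) by (simp add: o_def)
  qed
  have D\<psi>: "(\<psi> has_vector_derivative \<psi>' t) (at t)" if "0 \<le> t" "t \<le> cmod z" for t
    using \<psi>(1)[of t] that z by (simp add: has_real_derivative_iff_has_vector_derivative)
  have "cmod (F (of_real (cmod z) * e) - F (of_real 0 * e)) \<le> \<psi> (cmod z) - \<psi> 0"
  proof (rule differentiable_bound_general[where f = "\<lambda>t. F (of_real t * e)"])
    show "continuous_on {0..cmod z} (\<lambda>t. F (of_real t * e))"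
      using D by (intro continuous_at_imp_continuous_on ballI has_vector_derivative_continuous) auto
    show "continuous_on {0..cmod z} \<psi>"
      using D\<psi> by (intro continuous_at_imp_continuous_on ballI has_vector_derivative_continuous) auto
    fix t assume t: "0 < t" "t < cmod z"
    show "((\<lambda>t. F (of_real t * e)) has_vector_derivative e * F' (of_real t * e)) (at t)"
      using D t by simp
    show "(\<psi> has_vector_derivative \<psi>' t) (at t)"
      using D\<psi> t by simp
    show "cmod (e * F' (of_real t * e)) \<le> \<psi>' t"
      using le[of "of_real t * e"] te[of t] t z e(1) by (simp add: norm_mult)
  qed (use False in simp)
  then show ?thesis
    using F(2) \<psi>(2) e(2) by simp
qed

text \<open>The upper distortion bound is exactly the derivative of the Koebe function
  \<open>t / (1 - t)^2\<close> on the radius.\<close>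

lemma koebe_growth_upper:
  assumes g: "schlicht g" and z: "cmod z < 1"
  shows "cmod (g z) \<le> cmod z / (1 - cmod z)\<^sup>2"
proof (rule norm_le_radial_primitive)
  show "(g has_field_derivative deriv g w) (at w)" if "cmod w < 1" for w
    using schlicht_DERIV(1)[OF g] that by simp
  show "cmod (deriv g w) \<le> (1 + cmod w) / (1 - cmod w) ^ 3" if "cmod w < 1" for w
    by (rule koebe_distortion(2)[OF g that])
  show "((\<lambda>t. t / (1 - t)\<^sup>2) has_real_derivative (1 + t) / (1 - t) ^ 3) (at t)"
    if "0 \<le> t" "t < 1" for t :: real
    using that by (auto intro!: derivative_eq_intros simp: divide_simps power2_eq_square power3_eq_cube)
                  (simp add: algebra_simps)
qed (use g z in \<open>auto simp: schlicht_def\<close>)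

text \<open>The Koebe transform bound and distortion give
  \<open>|g''| \<le> (4 + 2 * t) / (1 - t)^4\<close> for \<open>t = |u|\<close>. Multiplied by
  \<open>t\<close>, the right side has primitive \<open>2 * t^2 / (1 - t)^3\<close>. The Koebe
  function attains the bound on the positive axis.\<close>

lemma schlicht_newton_bound:
  assumes g: "schlicht g" and w: "cmod w < 1"
  shows "cmod (g w - w * deriv g w) \<le> 2 * (cmod w)\<^sup>2 / (1 - cmod w) ^ 3"
proof (rule norm_le_radial_primitive)
  show "((\<lambda>w. g w - w * deriv g w) has_field_derivative - u * deriv (deriv g) u) (at u)"
    if "cmod u < 1" for u
    using schlicht_DERIV[OF g, of u] that by (auto intro!: derivative_eq_intros)
  show "((\<lambda>t. 2 * t\<^sup>2 / (1 - t) ^ 3) has_real_derivative (4 * t + 2 * t\<^sup>2) / (1 - t) ^ 4) (at t)"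
    if "0 \<le> t" "t < 1" for t :: real
    using that by (auto intro!: derivative_eq_intros simp: divide_simps power2_eq_square power3_eq_cube power4_eq_xxxx)
                  (simp add: algebra_simps)
  show "cmod (- u * deriv (deriv g) u) \<le> (4 * cmod u + 2 * (cmod u)\<^sup>2) / (1 - cmod u) ^ 4"
    if u: "cmod u < 1" for u
  proof -
    define t where "t = cmod u"
    have t: "0 \<le> t" "t < 1" using u by (auto simp: t_def)
    then have t2: "t\<^sup>2 < 1" by (simp add: abs_square_less_1)
    have "cmod (of_real (1 - t\<^sup>2) * deriv (deriv g) u) \<le>
        cmod (of_real (1 - t\<^sup>2) * deriv (deriv g) u - 2 * cnj u * deriv g u) + cmod (2 * cnj u * deriv g u)"
      by (metis diff_add_cancel norm_triangle_ineq)
    also have "\<dots> \<le> 4 * cmod (deriv g u) + 2 * t * cmod (deriv g u)"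
      using koebe_transform_bound[OF g u] by (simp add: t_def norm_mult)
    also have "\<dots> = (4 + 2 * t) * cmod (deriv g u)"
      by (simp add: algebra_simps)
    also have "\<dots> \<le> (4 + 2 * t) * ((1 + t) / (1 - t) ^ 3)"
      using koebe_distortion(2)[OF g u] t unfolding t_def by (intro mult_left_mono) auto
    finally have "(1 - t\<^sup>2) * cmod (deriv (deriv g) u) \<le> (4 + 2 * t) * ((1 + t) / (1 - t) ^ 3)"
      using t2 by (simp only: norm_mult norm_of_real)
    then have "cmod (deriv (deriv g) u) \<le> (4 + 2 * t) * ((1 + t) / (1 - t) ^ 3) / (1 - t\<^sup>2)"
      using t2 by (subst pos_le_divide_eq) (simp_all only: mult.commute diff_gt_0_iff_gt)
    also have "\<dots> = (4 + 2 * t) / (1 - t) ^ 4"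
    proof -
      have "1 - t\<^sup>2 = (1 + t) * (1 - t)" by (simp add: power2_eq_square algebra_simps)
      then show ?thesis
        using t by (simp add: divide_simps power3_eq_cube power4_eq_xxxx)
    qed
    finally have "t * cmod (deriv (deriv g) u) \<le> t * ((4 + 2 * t) / (1 - t) ^ 4)"
      using t by (intro mult_left_mono)
    then show ?thesis
      by (simp add: t_def norm_mult algebra_simps power2_eq_square)
  qed
qed (use g w in \<open>auto simp: schlicht_def\<close>)

text \<open>If \<open>g\<close> omits \<open>c\<close>, then \<open>c * g / (c - g)\<close> is
  schlicht too, with second derivative \<open>g'' + 2 / c\<close> at 0. Bieberbach's bound for both
  functions gives \<open>|2 / c| \<le> 8\<close>.\<close>

theorem koebe_quarter:
  assumes g: "schlicht g"
  shows "ball 0 (1/4) \<subseteq> g ` ball 0 1"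
proof (rule ccontr)
  assume "\<not> ball 0 (1/4) \<subseteq> g ` ball 0 1"
  then obtain c where c: "cmod c < 1/4" "c \<notin> g ` ball 0 1"
    by (meson mem_ball_0 subsetI)
  have g0: "g 0 = 0" and g1: "deriv g 0 = 1" using g by (auto simp: schlicht_def)
  have "c \<noteq> 0" using c(2) g0 by (metis centre_in_ball image_eqI zero_less_one)
  have ne: "g z \<noteq> c" if "z \<in> ball 0 1" for z using c(2) that by auto
  define G where "G z = c * g z / (c - g z)" for z
  have DG: "(G has_field_derivative c\<^sup>2 * deriv g z / (c - g z)\<^sup>2) (at z)" if "z \<in> ball 0 1" for z
    unfolding G_def[abs_def] using schlicht_DERIV(1)[OF g that] ne[OF that]
    by (auto intro!: derivative_eq_intros simp: field_simps power2_eq_square)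
  have "schlicht G"
    unfolding schlicht_def
  proof (intro conjI)
    show "G holomorphic_on ball 0 1"
      unfolding holomorphic_on_open[OF open_ball] using DG by meson
    show "G 0 = 0" by (simp add: G_def g0)
    show "deriv G 0 = 1"
      using DG[of 0] \<open>c \<noteq> 0\<close> by (simp add: DERIV_imp_deriv g0 g1)
    show "inj_on G (ball 0 1)"
    proof (rule inj_onI)
      fix x y assume xy: "x \<in> ball 0 1" "y \<in> ball 0 1" "G x = G y"
      then have "c * c * g x = c * c * g y"
        using ne[OF xy(1)] ne[OF xy(2)] by (simp add: G_def field_simps)
      then have "g x = g y" using \<open>c \<noteq> 0\<close> by simp
      then show "x = y" using g xy by (auto simp: schlicht_def dest: inj_onD)
    qed
  qed
  moreover have "deriv (deriv G) 0 = deriv (deriv g) 0 + 2 / c"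
  proof (rule DERIV_imp_deriv)
    have "((\<lambda>z. c\<^sup>2 * deriv g z / (c - g z)\<^sup>2) has_field_derivative deriv (deriv g) 0 + 2 / c) (at 0)"
      using schlicht_DERIV[OF g, of 0] \<open>c \<noteq> 0\<close>
      by (auto intro!: derivative_eq_intros simp: g0 g1 field_simps power2_eq_square)
    then show "(deriv G has_field_derivative deriv (deriv g) 0 + 2 / c) (at 0)"
      by (rule has_field_derivative_transform_within_open[of _ _ _ "ball 0 1"])
         (auto simp: DERIV_imp_deriv[OF DG])
  qed
  ultimately have "cmod (deriv (deriv g) 0 + 2 / c) \<le> 4"
    using bieberbach_second_coefficient by metis
  moreover have "cmod (2 / c) \<le> cmod (deriv (deriv g) 0 + 2 / c) + cmod (deriv (deriv g) 0)"
    by (metis add_diff_cancel_left' norm_triangle_ineq4)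
  ultimately have "cmod (2 / c) \<le> 8"
    using bieberbach_second_coefficient[OF g] by linarith
  then show False
    using c(1) \<open>c \<noteq> 0\<close> by (simp add: norm_divide field_simps)
qed

text \<open>Along the segment from \<open>0\<close> to \<open>g w\<close>, which lies in the image by the quarter theorem, the
  Koebe function of the modulus of the inverse of \<open>g\<close> grows with slope at most \<open>cmod (g w)\<close>.\<close>

lemma koebe_growth_lower:
  assumes g: "schlicht g" and w: "cmod w < 1" and gw: "cmod (g w) < 1/4"
  shows "cmod w / (1 + cmod w)\<^sup>2 \<le> cmod (g w)"
proof (cases "w = 0")
  case False
  have hol: "g holomorphic_on ball 0 1" and inj: "inj_on g (ball 0 1)" and g0: "g 0 = 0"
    using g by (auto simp: schlicht_def)
  obtain f where f: "f holomorphic_on g ` ball 0 1"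
      "\<And>z. z \<in> ball 0 1 \<Longrightarrow> deriv g z * deriv f (g z) = 1"
      "\<And>z. z \<in> ball 0 1 \<Longrightarrow> f (g z) = z"
    using holomorphic_has_inverse[OF hol open_ball inj] by blast
  define z where "z = g w"
  have "z \<noteq> 0" using schlicht_eq_0_iff[OF g, of w] w False by (simp add: z_def)
  have tz: "of_real t * z \<in> ball 0 (1/4)" if "0 \<le> t" "t \<le> 1" for t
  proof -
    have "t * cmod z \<le> 1 * cmod z" using that by (intro mult_right_mono) auto
    then show ?thesis using gw that by (simp add: norm_mult z_def)
  qed
  define p where "p t = f (of_real t * z)" for t
  have p: "p t \<in> ball 0 1" "g (p t) = of_real t * z" if "0 \<le> t" "t \<le> 1" for t
  proof -
    have "of_real t * z \<in> g ` ball 0 1"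
      using tz[OF that] koebe_quarter[OF g] by blast
    then obtain u where "u \<in> ball 0 1" "of_real t * z = g u"
      by auto
    then show "p t \<in> ball 0 1" "g (p t) = of_real t * z"
      using f(3) by (auto simp: p_def)
  qed
  have open_im: "open (g ` ball 0 1)"
    by (rule open_mapping_thm3[OF hol open_ball inj])
  have Dp: "(p has_vector_derivative z * deriv f (of_real t * z)) (at t)" if "0 \<le> t" "t \<le> 1" for t
  proof -
    have "of_real t * z \<in> g ` ball 0 1"
      using tz[OF that] koebe_quarter[OF g] by blast
    then have "(f has_field_derivative deriv f (of_real t * z)) (at (of_real t * z))"
      by (rule holomorphic_derivI[OF f(1) open_im])
    moreover have "((\<lambda>t. of_real t * z) has_vector_derivative z) (at t)"
      by (auto intro!: derivative_eq_intros simp: scaleR_conv_of_real)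
    ultimately show ?thesis
      using field_vector_diff_chain_at[of "\<lambda>t. of_real t * z" z t f]
      by (simp add: o_def p_def[abs_def])
  qed
  \<comment> \<open>The derivative of \<open>k\<close> is the lower distortion bound. Hence
    \<open>k (cmod (p t))\<close> has slope at most \<open>|deriv g (p t)|\<close> times the speed
    of \<open>p\<close>, and this product is \<open>cmod z\<close> because
    \<open>g (p t) = t * z\<close>.\<close>
  define k where "k r = r / (1 + r)\<^sup>2" for r :: real
  have "norm (k (cmod (p 1)) - k (cmod (p 0))) \<le> 1 * cmod z - 0 * cmod z"
  proof (rule differentiable_bound_general[where f = "\<lambda>t. k (cmod (p t))" and \<phi> = "\<lambda>t. t * cmod z"])
    have "continuous_on {0..1} p"
      using Dp by (intro continuous_at_imp_continuous_on ballI has_vector_derivative_continuous) auto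
    moreover have "1 + cmod u \<noteq> 0" for u :: complex by (smt (verit) norm_ge_zero)
    ultimately show "continuous_on {0..1} (\<lambda>t. k (cmod (p t)))"
      unfolding k_def by (intro continuous_intros) auto
    \<comment> \<open>The modulus is not differentiable at 0, where \<open>p\<close> starts;
      derivatives are required only for \<open>0 < t < 1\<close>, where \<open>p t\<close> is
      nonzero.\<close>
    fix t :: real assume t: "0 < t" "t < 1"
    then have t': "0 \<le> t" "t \<le> 1" by auto
    define a where "a = cmod (p t)"
    have a: "0 < a" "a < 1"
      using p[OF t'] t \<open>z \<noteq> 0\<close> g0 by (auto simp: a_def)
    then have "p t \<noteq> 0" by (auto simp: a_def)
    define p' where "p' = z * deriv f (of_real t * z)"
    have "(norm has_derivative (\<lambda>h. h \<bullet> sgn (p t))) (at (p t))"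
      using has_derivative_norm[OF \<open>p t \<noteq> 0\<close>] .
    moreover have "(p has_derivative (\<lambda>h. h *\<^sub>R p')) (at t)"
      using Dp[OF t'] by (simp add: has_vector_derivative_def p'_def)
    ultimately have "((\<lambda>t. norm (p t)) has_derivative (\<lambda>h. (h *\<^sub>R p') \<bullet> sgn (p t))) (at t)"
      by (rule has_derivative_compose[rotated])
    then have Dn: "((\<lambda>t. cmod (p t)) has_real_derivative (p' \<bullet> sgn (p t))) (at t)"
      by (simp add: has_field_derivative_def mult_commute_abs)
    have Dk: "(k has_real_derivative (1 - a) / (1 + a) ^ 3) (at a)"
      unfolding k_def[abs_def] using a
      by (auto intro!: derivative_eq_intros simp: divide_simps power2_eq_square power3_eq_cube)
         (simp add: algebra_simps)
    show "((\<lambda>t. k (cmod (p t))) has_vector_derivative ((1 - a) / (1 + a) ^ 3 * (p' \<bullet> sgn (p t)))) (at t)"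
      unfolding has_real_derivative_iff_has_vector_derivative[symmetric]
      using DERIV_chain2[OF Dk[unfolded a_def] Dn] by (simp only: a_def)
    show "((\<lambda>t. t * cmod z) has_vector_derivative cmod z) (at t)"
      by (auto intro!: derivative_eq_intros)
    have "\<bar>p' \<bullet> sgn (p t)\<bar> \<le> cmod p'"
      using Cauchy_Schwarz_ineq2[of p' "sgn (p t)"] \<open>p t \<noteq> 0\<close> by (simp add: norm_sgn)
    moreover have "(1 - a) / (1 + a) ^ 3 * cmod p' \<le> cmod z"
    proof -
      have "deriv g (p t) * deriv f (of_real t * z) = 1"
        using f(2)[OF p(1)[OF t']] p(2)[OF t'] by simp
      then have "cmod (deriv g (p t)) * cmod p' = cmod z"
        by (metis p'_def mult.left_commute mult.right_neutral norm_mult)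
      moreover have "(1 - a) / (1 + a) ^ 3 \<le> cmod (deriv g (p t))"
        using koebe_distortion(1)[OF g, of "p t"] p(1)[OF t'] by (simp add: a_def)
      ultimately show ?thesis
        by (metis mult_right_mono norm_ge_zero)
    qed
    moreover have "0 \<le> (1 - a) / (1 + a) ^ 3" using a by simp
    ultimately have "(1 - a) / (1 + a) ^ 3 * \<bar>p' \<bullet> sgn (p t)\<bar> \<le> cmod z"
      by (meson mult_left_mono order_trans)
    then show "norm ((1 - a) / (1 + a) ^ 3 * (p' \<bullet> sgn (p t))) \<le> cmod z"
      using \<open>0 \<le> (1 - a) / (1 + a) ^ 3\<close> by (simp only: real_norm_def abs_mult abs_of_nonneg)
  qed (auto intro!: continuous_intros)
  moreover have "p 1 = w" "p 0 = 0"
    using f(3)[of w] f(3)[of 0] w g0 by (auto simp: p_def z_def)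
  ultimately show ?thesis
    by (simp add: k_def z_def)
qed simp

subsection \<open>The Newton map of the inverse\<close>

lemma newton_map_inverse:
  assumes g: "schlicht g" and w: "w \<in> ball 0 1"
  shows "newton_map (inv_into (ball 0 1) g) (g w) = g w - w * deriv g w"
proof -
  have inv: "inv_into (ball 0 1) g (g u) = u" if "u \<in> ball 0 1" for u
    using g that by (intro inv_into_f_f) (auto simp: schlicht_def)
  have "(inv_into (ball 0 1) g has_field_derivative inverse (deriv g w)) (at (g w))"
    using g w schlicht_DERIV(1)[OF g w] schlicht_deriv_nonzero[OF g w] inv
    by (intro has_field_derivative_inverse_strong[of g _ w "ball 0 1"])
       (auto simp: schlicht_def holomorphic_on_imp_continuous_on)
  then show ?thesis
    by (simp add: newton_map_def DERIV_imp_deriv inv[OF w] divide_inverse)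
qed

text \<open>Here \<open>0.17 / (1 + 0.17)\<^sup>2 > 0.122\<close>, so the preimages have modulus at most \<open>0.17\<close>, where
  \<open>2 * r * (1 + r)\<^sup>2 < 0.9 * (1 - r) ^ 3\<close>.\<close>

lemma newton_map_contraction:
  assumes g: "schlicht g" and z: "cmod z < 0.122"
  shows "z \<in> g ` ball 0 1" and "cmod (newton_map (inv_into (ball 0 1) g) z) \<le> 0.9 * cmod z"
proof -
  have "z \<in> ball 0 (1/4)" using z by simp
  then show im: "z \<in> g ` ball 0 1" using koebe_quarter[OF g] by blast
  then obtain w where w: "w \<in> ball 0 1" "z = g w" by blast
  define r where "r = cmod w"
  have r: "0 \<le> r" "r < 1" using w by (auto simp: r_def)
  have low: "r / (1 + r)\<^sup>2 \<le> cmod z"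
    using koebe_growth_lower[OF g, of w] w z by (simp add: r_def)
  have small: "r \<le> 0.17"
  proof (rule ccontr)
    assume "\<not> r \<le> 0.17"
    \<comment> \<open>On the interval from 0.17 to 1 this bounds \<open>r^2\<close> by its chord,
      which makes the inequality to be refuted linear in \<open>r\<close>.\<close>
    then have "0 \<le> (r - 0.17) * (1 - r)" using r by simp
    also have "\<dots> = 1.17 * r - 0.17 - r\<^sup>2"
      by (simp add: power2_eq_square field_simps)
    finally have "0.122 * (1 + 2 * r + r\<^sup>2) \<le> r"
      using \<open>\<not> r \<le> 0.17\<close> by simp
    then have "0.122 * (1 + r)\<^sup>2 \<le> r"
      by (simp add: power2_eq_square algebra_simps)
    then have "0.122 \<le> r / (1 + r)\<^sup>2"
      using r by (simp add: pos_le_divide_eq)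
    then show False using low z by linarith
  qed
  have "2 * r * (1 + r)\<^sup>2 \<le> 2 * 0.17 * (1 + 0.17)\<^sup>2"
    using r small by (intro mult_mono power_mono) auto
  also have "\<dots> \<le> 0.9 * (1 - 0.17) ^ 3"
    by (simp add: power2_eq_square power3_eq_cube)
  also have "\<dots> \<le> 0.9 * (1 - r) ^ 3"
    using small by (intro mult_left_mono power_mono) auto
  finally have "r * (2 * r * (1 + r)\<^sup>2) \<le> r * (0.9 * (1 - r) ^ 3)"
    using r by (intro mult_left_mono)
  then have "2 * r\<^sup>2 * (1 + r)\<^sup>2 \<le> (0.9 * r) * (1 - r) ^ 3"
    by (simp add: power2_eq_square mult_ac)
  then have "2 * r\<^sup>2 / (1 - r) ^ 3 \<le> 0.9 * r / (1 + r)\<^sup>2"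
    using r by (intro frac_le_eq[THEN iffD2]) (auto simp: field_simps)
  also have "\<dots> \<le> 0.9 * cmod z"
    using low by simp
  finally show "cmod (newton_map (inv_into (ball 0 1) g) z) \<le> 0.9 * cmod z"
    using schlicht_newton_bound[OF g, of w] w by (simp add: newton_map_inverse[OF g] r_def)
qed

text \<open>The contraction traps every orbit in the ball and drives it to \<open>p\<close>
  geometrically. The ball is connected and contains \<open>p\<close>, so it lies in one component of
  the basin.\<close>

lemma ball_subset_immediate_basin:
  assumes sub: "ball p R \<subseteq> \<Omega>" and c: "c < 1" and R: "0 < R"
    and contr: "\<And>z. z \<in> ball p R \<Longrightarrow> dist p (N z) \<le> c * dist p z"
  shows "ball p R \<subseteq> immediate_basin \<Omega> N p"
  unfolding immediate_basin_def
proof (rule connected_component_maximal)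
  show "ball p R \<subseteq> basin_of_attraction \<Omega> N p"
  proof
    fix z assume z: "z \<in> ball p R"
    \<comment> \<open>The factor \<open>c\<close> may be negative, while the powers in the geometric
      bound need a nonnegative one.\<close>
    define d where "d = max c 0"
    have d: "0 \<le> d" "d < 1" using c by (auto simp: d_def)
    have contr': "dist p (N u) \<le> d * dist p u" if "u \<in> ball p R" for u
      using contr[OF that] mult_right_mono[of c d "dist p u"] by (auto simp: d_def)
    have iter: "(N ^^ n) z \<in> ball p R \<and> dist p ((N ^^ n) z) \<le> d ^ n * dist p z" for n
    proof (induction n)
      case (Suc n)
      let ?u = "(N ^^ n) z"
      have "dist p (N ?u) \<le> d * dist p ?u" using contr' Suc by blast
      moreover have "d * dist p ?u \<le> d * (d ^ n * dist p z)"
        using Suc d by (intro mult_left_mono) auto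
      moreover have "d * dist p ?u \<le> 1 * dist p ?u"
        using d by (intro mult_right_mono) auto
      ultimately show ?case using Suc by (auto simp: mult.assoc)
    qed (use z in auto)
    have "(\<lambda>n. d ^ n * dist p z) \<longlonglongrightarrow> 0"
      using d by (intro tendsto_mult_left_zero LIMSEQ_power_zero) auto
    then have "(\<lambda>n. dist ((N ^^ n) z) p) \<longlonglongrightarrow> 0"
      by (rule Lim_null_comparison[rotated]) (use iter in \<open>auto simp: dist_commute\<close>)
    then have "(\<lambda>n. (N ^^ n) z) \<longlonglongrightarrow> p"
      using tendsto_dist_iff by blast
    then show "z \<in> basin_of_attraction \<Omega> N p"
      unfolding basin_of_attraction_def using iter sub z by blast
  qed
qed (use R in auto)

theorem theorem13:
  shows "\<exists>\<rho>\<^sub>1 \<beta>\<^sub>1 :: real.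
    \<bar>\<rho>\<^sub>1 - 0.121507\<bar> < 0.0000005 \<and> \<bar>\<beta>\<^sub>1 - 0.0987043\<bar> < 0.00000005 \<and>
    (\<forall>g :: complex \<Rightarrow> complex.
       g analytic_on ball 0 1 \<and> inj_on g (ball 0 1) \<and> g 0 = 0 \<and> deriv g 0 = 1 \<longrightarrow>
       g ` ball 0 \<beta>\<^sub>1 \<subseteq> ball 0 \<rho>\<^sub>1 \<and>
       ball 0 \<rho>\<^sub>1 \<subseteq>
         immediate_basin (g ` ball 0 1) (newton_map (inv_into (ball 0 1) g)) 0)"
proof (intro exI conjI allI impI)
  \<comment> \<open>For this \<open>?\<beta>\<close> the growth bound
    \<open>?\<beta> / (1 - ?\<beta>)^2\<close> is about 0.12150705, just above 0.121507. Hence the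
    extra digit in \<open>?\<rho>\<close>, which remains below the 0.122 of
    \<open>newton_map_contraction\<close>.\<close>
  let ?\<rho> = "0.1215072 :: real" and ?\<beta> = "0.0987043 :: real"
  show "\<bar>?\<rho> - 0.121507\<bar> < 0.0000005" "\<bar>?\<beta> - 0.0987043\<bar> < 0.00000005"
    by simp_all
  fix g :: "complex \<Rightarrow> complex"
  assume "g analytic_on ball 0 1 \<and> inj_on g (ball 0 1) \<and> g 0 = 0 \<and> deriv g 0 = 1"
  then have g: "schlicht g"
    by (simp add: schlicht_def analytic_imp_holomorphic)
  show "g ` ball 0 ?\<beta> \<subseteq> ball 0 ?\<rho>"
  proof clarify
    fix w :: complex assume "w \<in> ball 0 ?\<beta>"
    then have w: "cmod w \<le> ?\<beta>" by simp
    then have "cmod (g w) \<le> cmod w / (1 - cmod w)\<^sup>2"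
      by (intro koebe_growth_upper[OF g]) simp
    also have "\<dots> \<le> ?\<beta> / (1 - ?\<beta>)\<^sup>2"
      using w by (intro frac_le power_mono) auto
    also have "\<dots> < ?\<rho>"
      by (simp add: power2_eq_square)
    finally show "g w \<in> ball 0 ?\<rho>" by simp
  qed
  show "ball 0 ?\<rho> \<subseteq> immediate_basin (g ` ball 0 1) (newton_map (inv_into (ball 0 1) g)) 0"
    by (rule ball_subset_immediate_basin[where c = "0.9"])
       (use newton_map_contraction[OF g] in auto)
qed

end
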